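(* Let $G$ be a Chaplygin type symmetry group of the nonholonomic discrete mechanical system $(Q,L_d,\mathcal{D},\mathcal{D}_d)$, let $q_\cdot=(q_0,\dots,q_N)$ be a discrete curve in $Q$ and $r_k:=\pi(q_k)$ the corresponding curve in $Q/G$. If $(q_k,q_{k+1})\in\mathcal{D}_d$ for all $k$, the following statements are equivalent. (1) $dS_d(q_\cdot)(\delta q_\cdot)=0$ for all vanishing end points variations $\delta q_\cdot$ such that $\delta q_k\in\mathcal{D}_{q_k}$ for all $k$. (2) $q_\cdot$ satisfies the discrete Lagrange--D'Alembert equations: $D_1L_d(q_k,q_{k+1})+D_2L_d(q_{k-1},q_k)\in\mathcal{D}_{q_k}^\circ$ for all $1\le k\le N-1$ and $(q_k,q_{k+1})\in\mathcal{D}_d$ for all $0\le k\le N-1$. (3) $r_\cdot$ satisfies $$d\breve{S}_d(r_\cdot)(\delta r_\cdot)=-\sum_{k=1}^{N-1}\big(\breve{F}_d^-(r_k,r_{k+1})+\breve{F}_d^+(r_{k-1},r_k)\big)(\delta r_k)$$ for all vanishing end points variations $\delta r_\cdot$ with $\delta r_k\in T_{r_k}(Q/G)$, where $\breve{S}_d(r_\cdot):=\sum_{k=0}^{N-1}\breve{L}_d(r_k,r_{k+1})$. (4) $r_\cdot$ satisfies, for all $1\le k\le N-1$, $$D_1\breve{L}_d(r_k,r_{k+1})+D_2\breve{L}_d(r_{k-1},r_k)=-\big(\breve{F}_d^+(r_{k-1},r_k)+\breve{F}_d^-(r_k,r_{k+1})\big).$$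
   Context: All manifolds and maps are smooth. $G$ is a Lie group with Lie algebra $\mathfrak{g}$ and identity $e$, acting on the left, freely and properly on a manifold $Q$ by $l^Q_g(q)$, so that $\pi:Q\to Q/G$ is a principal bundle. Notation: $l^{TQ}_g=dl^Q_g$ (lifted action); $l^{Q\times Q}_g(q_0,q_1)=(l^Q_g(q_0),l^Q_g(q_1))$ (diagonal action); $l^G_g(h)=ghg^{-1}$; $\mathcal{V}^G_q=T_q(l^Q_G(\{q\}))$; $D_j$ is differentiation with respect to the $j$-th factor; $p_j$ is the projection on the $j$-th factor; $^\circ$ denotes annihilator. Systems. A nonholonomic discrete mechanical system is $(Q,L_d,\mathcal{D},\mathcal{D}_d)$ with $L_d:Q\times Q\to\mathbb{R}$ smooth, $\mathcal{D}$ a subbundle of $TQ$ and $\mathcal{D}_d\subset Q\times Q$ a submanifold. $G$ is a symmetry group of it if $G$ acts on the left, freely and properly on $Q$ by $l^Q$ (so that $\pi:Q\to Q/G$ is a principal bundle), $L_d$ and $\mathcal{D}_d$ are invariant under the diagonal action and $\mathcal{D}$ under the lifted action. A discrete curve is a map $q_\cdot:\{0,\dots,N\}\to Q$; a variation is $\delta q_\cdot$ with $\delta q_k\in T_{q_k}Q$, with vanishing end points if $\delta q_0=0$, $\delta q_N=0$; $S_d(q_\cdot)=\sum_{k=0}^{N-1}L_d(q_k,q_{k+1})$. Affine discrete connection. Let $\gamma:Q\to G$ be smooth and $G$-equivariant for $l^Q$ and $l^G$, $\Gamma=\{(q,l^Q_{\gamma(q)}(q)):q\in Q\}$, and $Hor\subset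 Q\times Q$ a $G$-invariant submanifold with $\Gamma\subset Hor$; put $Hor^2(q)=p_2(Hor\cap(\{q\}\times Q))$. $Hor$ defines an affine discrete connection $\mathcal{A}_d$ of level $\gamma$ if for each $q\in Q$, $Hor^2(q)$ is a submanifold of $Q$ and $T_{q_1}Q=T_{q_1}(l^Q_G(\{q\}))\oplus T_{q_1}Hor^2(q)$ for all $q_1\in l^Q_G(\{q\})\cap Hor^2(q)$. Then there are a $G$-invariant open neighborhood $U$ of $\Gamma$ and an open neighborhood $\mathcal{O}$ of the diagonal in $(Q/G)\times(Q/G)$ such that for all $(q_0,q_1)\in\mathfrak{U}:=(\pi\times\pi)^{-1}(\mathcal{O})$ there is a unique $g\in G$ with $(q_0,l^Q_{g^{-1}}(q_1))\in Hor\cap U$; fix such $U,\mathcal{O}$ and set $\mathcal{A}_d(q_0,q_1):=g$ (smooth on $\mathfrak{U}$). For $(\pi(q_0),r_1)\in\mathcal{O}$, $\overline{h_d^{q_0}}(r_1)$ is the unique $q_1$ with $\pi(q_1)=r_1$ and $\mathcal{A}_d(q_0,q_1)=e$. Convention: the notation treats $\mathcal{A}_d$ as defined everywhere; all pairs at which $\mathcal{A}_d$ is evaluated are assumed to be in $\mathfrak{U}$, and horizontal pairs (elements of $Hor$) are taken in $U\cap\mathfrak{U}$, so that $(q_0,q_1)\in Hor$ iff $\mathcal{A}_d(q_0,q_1)=e$; $Q\times G\times(Q/G)$, $\tilde{G}\times(Q/G)$ and $(Q/G)\times(Q/G)$ stand for the corresponding open subsets where $(\pi(q_0),r_1)\in\mathcal{O}$,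 resp. $(r_0,r_1)\in\mathcal{O}$. Chaplygin symmetry. A symmetry group $G$ of $(Q,L_d,\mathcal{D},\mathcal{D}_d)$ is a Chaplygin type symmetry group if (i) $TQ=\mathcal{V}^G\oplus\mathcal{D}$ and (ii) $\mathcal{D}_d$ defines an affine discrete connection $\mathcal{A}_d$ on $\pi$, i.e. $Hor=\mathcal{D}_d$. In that case $\mathcal{A}$ denotes the principal connection on $\pi$ with horizontal bundle $\mathcal{D}$ and $h^q:T_{\pi(q)}(Q/G)\to T_qQ$ its horizontal lift. Reduced objects. $\tilde{G}=(Q\times G)/G$ for the action $g\cdot(q,w)=(l^Q_g(q),gwg^{-1})$, with quotient map $\rho$. $\tilde{F}_1(q_0,w_0,r_1)=l^Q_{w_0}(\overline{h_d^{q_0}}(r_1))$; $\check{L}_d(q_0,w_0,r_1)=L_d(q_0,\tilde{F}_1(q_0,w_0,r_1))$; $\hat{L}_d(\rho(q_0,w_0),r_1)=\check{L}_d(q_0,w_0,r_1)$. For $v_0=\rho(q_0,w_0)$ and $q_1=\tilde{F}_1(q_0,w_0,r_1)$, $\hat{F}_d^+(v_0,r_1)(\delta r_1)=D_2\check{L}_d(q_0,w_0,r_1)\,D_2\mathcal{A}_d(q_0,q_1)(h^{q_1}(\delta r_1))$, $\hat{F}_d^-(v_0,r_1)(\delta r_0)=D_2\check{L}_d(q_0,w_0,r_1)\,D_1\mathcal{A}_d(q_0,q_1)(h^{q_0}(\delta r_0))$ and $\hat{F}_d=\hat{F}_d^-+\hat{F}_d^+$. Let $\mathcal{Y}(r_0,r_1)=(\rho(q_0,e),r_1)$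 for any $q_0\in\pi^{-1}(r_0)$ (well defined), $\breve{L}_d=\hat{L}_d\circ\mathcal{Y}:(Q/G)\times(Q/G)\to\mathbb{R}$ and $\breve{F}_d=\mathcal{Y}^*\hat{F}_d$, i.e. $\breve{F}_d^\pm(r_0,r_1)=\hat{F}_d^\pm(\rho(q_0,e),r_1)$ for $q_0\in\pi^{-1}(r_0)$. *)

theory Defs
  imports "HOL-Analysis.Analysis" "HOL-Algebra.Group_Action"
begin

section \<open>Smooth manifolds\<close>

primrec Ck_on :: "nat \<Rightarrow> 'a::real_normed_vector set \<Rightarrow> ('a \<Rightarrow> 'b::real_normed_vector) \<Rightarrow> bool" where
  "Ck_on 0 S f \<longleftrightarrow> continuous_on S f"
| "Ck_on (Suc k) S f \<longleftrightarrow> (\<forall>x\<in>S. f differentiable (at x)) \<and>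
     (\<forall>v. Ck_on k S (\<lambda>x. frechet_derivative f (at x) v))"

text \<open>Only meant for open \<open>S\<close> in a finite-dimensional space.\<close>

definition smooth_on :: "'a::real_normed_vector set \<Rightarrow> ('a \<Rightarrow> 'b::real_normed_vector) \<Rightarrow> bool" where
  "smooth_on S f \<longleftrightarrow> (\<forall>k. Ck_on k S f)"

text \<open>
  A chart is a pair (domain, coordinate map). The model space is a finite-dimensional normed space
  rather than a \<open>euclidean_space\<close>, because the latter class excludes dimension zero
  (discrete groups, or a discrete space of orbits).
\<close>

type_synonym ('a, 'e) chart = "'a set \<times> ('a \<Rightarrow> 'e)"

record ('a, 'e) mfd =
  topo :: "'a topology"
  atlas :: "('a, 'e) chart set"

abbreviation pts :: "('a, 'e) mfd \<Rightarrow> 'a set" where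
  "pts M \<equiv> topspace (topo M)"

definition is_chart :: "('a, 'e::real_normed_vector) mfd \<Rightarrow> ('a, 'e) chart \<Rightarrow> bool" where
  "is_chart M = (\<lambda>(U, \<phi>). openin (topo M) U \<and> open (\<phi> ` U) \<and>
     homeomorphic_map (subtopology (topo M) U) (top_of_set (\<phi> ` U)) \<phi>)"

definition smooth_transition :: "('a, 'e::real_normed_vector) chart \<Rightarrow> ('a, 'e) chart \<Rightarrow> bool" where
  "smooth_transition = (\<lambda>(U, \<phi>) (V, \<psi>). smooth_on (\<phi> ` (U \<inter> V)) (\<psi> \<circ> inv_into U \<phi>))"

text \<open>Charts of the maximal atlas.\<close>

definition smooth_chart :: "('a, 'e::real_normed_vector) mfd \<Rightarrow> ('a, 'e) chart \<Rightarrow> bool" where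
  "smooth_chart M c \<longleftrightarrow> is_chart M c \<and>
     (\<forall>d\<in>atlas M. smooth_transition c d \<and> smooth_transition d c)"

definition smooth_manifold :: "('a, 'e::real_normed_vector) mfd \<Rightarrow> bool" where
  "smooth_manifold M \<longleftrightarrow>
     (\<exists>b :: 'e set. finite b \<and> span b = UNIV) \<and>
     Hausdorff_space (topo M) \<and> second_countable (topo M) \<and>
     (\<forall>c\<in>atlas M. smooth_chart M c) \<and> \<Union> (fst ` atlas M) = pts M"

definition real_mfd :: "(real, real) mfd" where
  "real_mfd = \<lparr>topo = euclidean, atlas = {(UNIV, id)}\<rparr>"

definition prod_mfd :: "('a, 'e) mfd \<Rightarrow> ('b, 'f) mfd \<Rightarrow> ('a \<times> 'b, 'e \<times> 'f) mfd" where
  "prod_mfd M N = \<lparr>topo = prod_topology (topo M) (topo N),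
     atlas = {(U \<times> V, map_prod \<phi> \<psi>) | U \<phi> V \<psi>. (U, \<phi>) \<in> atlas M \<and> (V, \<psi>) \<in> atlas N}\<rparr>"

definition smooth_map_on :: "('a, 'e::real_normed_vector) mfd \<Rightarrow> ('b, 'f::real_normed_vector) mfd \<Rightarrow>
    'a set \<Rightarrow> ('a \<Rightarrow> 'b) \<Rightarrow> bool" where
  "smooth_map_on M N A f \<longleftrightarrow> openin (topo M) A \<and>
     continuous_map (subtopology (topo M) A) (topo N) f \<and>
     (\<forall>(U, \<phi>)\<in>atlas M. \<forall>(V, \<psi>)\<in>atlas N.
        smooth_on (\<phi> ` {p \<in> A \<inter> U. f p \<in> V}) (\<psi> \<circ> f \<circ> inv_into U \<phi>))"

text \<open>
  Every point \<open>p\<close> gets a preferred chart. The tangent space at \<open>p\<close> is the whole model space: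
  a tangent vector is given by its coordinates in the preferred chart at its base point.
  Accordingly, the tangent map \<open>mfderiv M N f p\<close> is the derivative of \<open>f\<close> read in the preferred
  charts at \<open>p\<close> and at \<open>f p\<close>.
\<close>

definition chart_at :: "('a, 'e) mfd \<Rightarrow> 'a \<Rightarrow> ('a, 'e) chart" where
  "chart_at M p = (SOME c. c \<in> atlas M \<and> p \<in> fst c)"

definition chart_map :: "('a, 'e) mfd \<Rightarrow> 'a \<Rightarrow> 'a \<Rightarrow> 'e" where
  "chart_map M p = snd (chart_at M p)"

definition chart_inv :: "('a, 'e) mfd \<Rightarrow> 'a \<Rightarrow> 'e \<Rightarrow> 'a" where
  "chart_inv M p = inv_into (fst (chart_at M p)) (snd (chart_at M p))"

definition mfderiv :: "('a, 'e::real_normed_vector) mfd \<Rightarrow> ('b, 'f::real_normed_vector) mfd \<Rightarrow>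
    ('a \<Rightarrow> 'b) \<Rightarrow> 'a \<Rightarrow> 'e \<Rightarrow> 'f" where
  "mfderiv M N f p =
     frechet_derivative (chart_map N (f p) \<circ> f \<circ> chart_inv M p) (at (chart_map M p p))"

text \<open>The partial derivatives of a map on a product; the manifold argument is the factor in which
  one differentiates.\<close>

definition partial1 :: "('a, 'e::real_normed_vector) mfd \<Rightarrow> ('c, 'k::real_normed_vector) mfd \<Rightarrow>
    ('a \<times> 'b \<Rightarrow> 'c) \<Rightarrow> 'a \<times> 'b \<Rightarrow> 'e \<Rightarrow> 'k" where
  "partial1 M N f = (\<lambda>(x, y). mfderiv M N (\<lambda>x'. f (x', y)) x)"

definition partial2 :: "('b, 'e::real_normed_vector) mfd \<Rightarrow> ('c, 'k::real_normed_vector) mfd \<Rightarrow>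
    ('a \<times> 'b \<Rightarrow> 'c) \<Rightarrow> 'a \<times> 'b \<Rightarrow> 'e \<Rightarrow> 'k" where
  "partial2 M N f = (\<lambda>(x, y). mfderiv M N (\<lambda>y'. f (x, y')) y)"

definition submanifold :: "('a, 'e::real_normed_vector) mfd \<Rightarrow> 'a set \<Rightarrow> bool" where
  "submanifold M S \<longleftrightarrow> S \<subseteq> pts M \<and>
     (\<exists>k. \<forall>p\<in>S. \<exists>U \<phi> W. smooth_chart M (U, \<phi>) \<and> p \<in> U \<and> subspace W \<and> dim W = k \<and>
        \<phi> ` (S \<inter> U) = \<phi> ` U \<inter> W)"

text \<open>The tangent space at \<open>p\<close> of a submanifold \<open>S\<close>, as the set of velocities of curves in \<open>S\<close>.\<close>

definition tangent_space :: "('a, 'e::real_normed_vector) mfd \<Rightarrow> 'a set \<Rightarrow> 'a \<Rightarrow> 'e set" where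
  "tangent_space M S p = {mfderiv real_mfd M c 0 1 | c.
     c 0 = p \<and> (\<exists>\<epsilon>>0. smooth_map_on real_mfd M {-\<epsilon><..<\<epsilon>} c \<and> c ` {-\<epsilon><..<\<epsilon>} \<subseteq> S)}"

text \<open>In the chart \<open>(U, \<phi>)\<close> the vector field \<open>X\<close> has the coordinates used below, since \<open>X p\<close> itself is
  given in the preferred chart at \<open>p\<close>.\<close>

definition smooth_vector_field_on :: "('a, 'e::real_normed_vector) mfd \<Rightarrow> 'a set \<Rightarrow> ('a \<Rightarrow> 'e) \<Rightarrow> bool"
  where
  "smooth_vector_field_on M A X \<longleftrightarrow> openin (topo M) A \<and>
     (\<forall>(U, \<phi>)\<in>atlas M. smooth_on (\<phi> ` (A \<inter> U))
        (\<lambda>x. let p = inv_into U \<phi> x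
             in frechet_derivative (\<phi> \<circ> chart_inv M p) (at (chart_map M p p)) (X p)))"

definition tangent_subbundle :: "('a, 'e::real_normed_vector) mfd \<Rightarrow> ('a \<Rightarrow> 'e set) \<Rightarrow> bool" where
  "tangent_subbundle M D \<longleftrightarrow>
     (\<exists>k. \<forall>p\<in>pts M. subspace (D p) \<and> dim (D p) = k \<and>
        (\<exists>A X. openin (topo M) A \<and> p \<in> A \<and> (\<forall>i<k. smooth_vector_field_on M A (X i)) \<and>
           (\<forall>a\<in>A. D a = span ((\<lambda>i. X i a) ` {..<k}))))"

definition direct_sum :: "'e::real_vector set \<Rightarrow> 'e set \<Rightarrow> bool" where
  "direct_sum V W \<longleftrightarrow> subspace V \<and> subspace W \<and> V \<inter> W = {0} \<and>
     {v + w | v w. v \<in> V \<and> w \<in> W} = UNIV"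

definition annihilator :: "'e::real_vector set \<Rightarrow> ('e \<Rightarrow> real) set" where
  "annihilator V = {\<alpha>. linear \<alpha> \<and> (\<forall>v\<in>V. \<alpha> v = 0)}"


section \<open>Lie groups, actions and principal bundles\<close>

definition lie_group :: "('g, 'f::real_normed_vector) mfd \<Rightarrow> ('g, 'z) monoid_scheme \<Rightarrow> bool" where
  "lie_group MG G \<longleftrightarrow> group G \<and> smooth_manifold MG \<and> pts MG = carrier G \<and>
     smooth_map_on (prod_mfd MG MG) MG (carrier G \<times> carrier G) (\<lambda>(g, h). g \<otimes>\<^bsub>G\<^esub> h) \<and>
     smooth_map_on MG MG (carrier G) (\<lambda>g. inv\<^bsub>G\<^esub> g)"

definition smooth_free_proper_action ::
  "('q, 'e::real_normed_vector) mfd \<Rightarrow> ('g, 'f::real_normed_vector) mfd \<Rightarrow> ('g, 'z) monoid_scheme \<Rightarrow>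
   ('g \<Rightarrow> 'q \<Rightarrow> 'q) \<Rightarrow> bool" where
  "smooth_free_proper_action Q MG G l \<longleftrightarrow> group_action G (pts Q) l \<and>
     smooth_map_on (prod_mfd MG Q) Q (carrier G \<times> pts Q) (\<lambda>(g, q). l g q) \<and>
     (\<forall>q\<in>pts Q. stabilizer G l q = {\<one>\<^bsub>G\<^esub>}) \<and>
     proper_map (prod_topology (topo MG) (topo Q)) (prod_topology (topo Q) (topo Q))
       (\<lambda>(g, q). (l g q, q))"

text \<open>
  \<open>B\<close> is the manifold \<open>Q/G\<close>: its points are the orbits, the projection is \<open>orbit G l\<close>, and its
  smooth structure is the (unique) one for which the projection is a locally trivial principal
  \<open>G\<close>-bundle.
\<close>

definition principal_bundle ::
  "('q, 'e::real_normed_vector) mfd \<Rightarrow> ('g, 'f::real_normed_vector) mfd \<Rightarrow> ('g, 'z) monoid_scheme \<Rightarrow>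
   ('g \<Rightarrow> 'q \<Rightarrow> 'q) \<Rightarrow> ('q set, 'h::real_normed_vector) mfd \<Rightarrow> bool" where
  "principal_bundle Q MG G l B \<longleftrightarrow> smooth_manifold B \<and> pts B = orbits G (pts Q) l \<and>
     smooth_map_on Q B (pts Q) (orbit G l) \<and>
     (\<forall>r\<in>pts B. \<exists>V \<Phi>. openin (topo B) V \<and> r \<in> V \<and>
        (let P = {q \<in> pts Q. orbit G l q \<in> V} in
          bij_betw \<Phi> (V \<times> carrier G) P \<and>
          smooth_map_on (prod_mfd B MG) Q (V \<times> carrier G) \<Phi> \<and>
          smooth_map_on Q (prod_mfd B MG) P (inv_into (V \<times> carrier G) \<Phi>) \<and>
          (\<forall>s\<in>V. \<forall>h\<in>carrier G. orbit G l (\<Phi> (s, h)) = s \<and>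
             (\<forall>g\<in>carrier G. \<Phi> (s, g \<otimes>\<^bsub>G\<^esub> h) = l g (\<Phi> (s, h))))))"

definition diag_invariant :: "('g, 'z) monoid_scheme \<Rightarrow> ('g \<Rightarrow> 'q \<Rightarrow> 'q) \<Rightarrow> ('q \<times> 'q) set \<Rightarrow> bool" where
  "diag_invariant G l S \<longleftrightarrow> (\<forall>g\<in>carrier G. \<forall>(q0, q1)\<in>S. (l g q0, l g q1) \<in> S)"

definition vertical_space ::
  "('q, 'e::real_normed_vector) mfd \<Rightarrow> ('g, 'z) monoid_scheme \<Rightarrow> ('g \<Rightarrow> 'q \<Rightarrow> 'q) \<Rightarrow> 'q \<Rightarrow> 'e set" where
  "vertical_space Q G l q = tangent_space Q (orbit G l q) q"


section \<open>Nonholonomic discrete mechanical systems and their symmetries\<close>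

definition nonholonomic_discrete_system ::
  "('q, 'e::real_normed_vector) mfd \<Rightarrow> ('q \<times> 'q \<Rightarrow> real) \<Rightarrow> ('q \<Rightarrow> 'e set) \<Rightarrow> ('q \<times> 'q) set \<Rightarrow> bool" where
  "nonholonomic_discrete_system Q L D Dd \<longleftrightarrow> smooth_manifold Q \<and>
     smooth_map_on (prod_mfd Q Q) real_mfd (pts Q \<times> pts Q) L \<and>
     tangent_subbundle Q D \<and> submanifold (prod_mfd Q Q) Dd"

definition symmetry_group ::
  "('g, 'f::real_normed_vector) mfd \<Rightarrow> ('g, 'z) monoid_scheme \<Rightarrow> ('g \<Rightarrow> 'q \<Rightarrow> 'q) \<Rightarrow>
   ('q set, 'h::real_normed_vector) mfd \<Rightarrow>
   ('q, 'e::real_normed_vector) mfd \<Rightarrow> ('q \<times> 'q \<Rightarrow> real) \<Rightarrow> ('q \<Rightarrow> 'e set) \<Rightarrow> ('q \<times> 'q) set \<Rightarrow> bool" where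
  "symmetry_group MG G l B Q L D Dd \<longleftrightarrow>
     lie_group MG G \<and> smooth_free_proper_action Q MG G l \<and> principal_bundle Q MG G l B \<and>
     (\<forall>g\<in>carrier G. \<forall>q0\<in>pts Q. \<forall>q1\<in>pts Q. L (l g q0, l g q1) = L (q0, q1)) \<and>
     diag_invariant G l Dd \<and>
     (\<forall>g\<in>carrier G. \<forall>q\<in>pts Q. mfderiv Q Q (l g) q ` D q = D (l g q))"


section \<open>Affine discrete connections\<close>

definition level_graph :: "('q, 'e) mfd \<Rightarrow> ('g \<Rightarrow> 'q \<Rightarrow> 'q) \<Rightarrow> ('q \<Rightarrow> 'g) \<Rightarrow> ('q \<times> 'q) set" where
  "level_graph Q l \<gamma> = {(q, l (\<gamma> q) q) | q. q \<in> pts Q}"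

definition Hor2 :: "('q \<times> 'q) set \<Rightarrow> 'q \<Rightarrow> 'q set" where
  "Hor2 Hor q = snd ` (Hor \<inter> ({q} \<times> UNIV))"

definition affine_discrete_connection ::
  "('q, 'e::real_normed_vector) mfd \<Rightarrow> ('g, 'f::real_normed_vector) mfd \<Rightarrow> ('g, 'z) monoid_scheme \<Rightarrow>
   ('g \<Rightarrow> 'q \<Rightarrow> 'q) \<Rightarrow> ('q \<Rightarrow> 'g) \<Rightarrow> ('q \<times> 'q) set \<Rightarrow> bool" where
  "affine_discrete_connection Q MG G l \<gamma> Hor \<longleftrightarrow>
     smooth_map_on Q MG (pts Q) \<gamma> \<and>
     (\<forall>g\<in>carrier G. \<forall>q\<in>pts Q. \<gamma> (l g q) = g \<otimes>\<^bsub>G\<^esub> \<gamma> q \<otimes>\<^bsub>G\<^esub> inv\<^bsub>G\<^esub> g) \<and>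
     submanifold (prod_mfd Q Q) Hor \<and> diag_invariant G l Hor \<and> level_graph Q l \<gamma> \<subseteq> Hor \<and>
     (\<forall>q\<in>pts Q. submanifold Q (Hor2 Hor q) \<and>
        (\<forall>q1 \<in> orbit G l q \<inter> Hor2 Hor q.
           direct_sum (tangent_space Q (orbit G l q) q1) (tangent_space Q (Hor2 Hor q) q1)))"

definition disc_conn ::
  "('g, 'z) monoid_scheme \<Rightarrow> ('g \<Rightarrow> 'q \<Rightarrow> 'q) \<Rightarrow> ('q \<times> 'q) set \<Rightarrow> ('q \<times> 'q) set \<Rightarrow> 'q \<times> 'q \<Rightarrow> 'g" where
  "disc_conn G l Hor U = (\<lambda>(q0, q1). THE g. g \<in> carrier G \<and> (q0, l (inv\<^bsub>G\<^esub> g) q1) \<in> Hor \<inter> U)"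

text \<open>The inverse image under \<open>\<pi> \<times> \<pi>\<close> of a set \<open>N\<close> of pairs of orbits.\<close>

definition conn_domain ::
  "('q, 'e) mfd \<Rightarrow> ('g, 'z) monoid_scheme \<Rightarrow> ('g \<Rightarrow> 'q \<Rightarrow> 'q) \<Rightarrow> ('q set \<times> 'q set) set \<Rightarrow> ('q \<times> 'q) set"
  where
  "conn_domain Q G l N = {(q0, q1) \<in> pts Q \<times> pts Q. (orbit G l q0, orbit G l q1) \<in> N}"

text \<open>The admissible choices of the neighbourhoods \<open>U\<close> of the level graph and \<open>N\<close> of the diagonal of
  \<open>(Q/G) \<times> (Q/G)\<close> on which the discrete connection is based.\<close>

definition conn_neighbourhoods ::
  "('q, 'e::real_normed_vector) mfd \<Rightarrow> ('g, 'f::real_normed_vector) mfd \<Rightarrow> ('g, 'z) monoid_scheme \<Rightarrow>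
   ('g \<Rightarrow> 'q \<Rightarrow> 'q) \<Rightarrow> ('q set, 'h::real_normed_vector) mfd \<Rightarrow> ('q \<Rightarrow> 'g) \<Rightarrow> ('q \<times> 'q) set \<Rightarrow>
   ('q \<times> 'q) set \<Rightarrow> ('q set \<times> 'q set) set \<Rightarrow> bool" where
  "conn_neighbourhoods Q MG G l B \<gamma> Hor U N \<longleftrightarrow>
     openin (prod_topology (topo Q) (topo Q)) U \<and> diag_invariant G l U \<and> level_graph Q l \<gamma> \<subseteq> U \<and>
     openin (prod_topology (topo B) (topo B)) N \<and> (\<forall>r\<in>pts B. (r, r) \<in> N) \<and>
     (\<forall>(q0, q1)\<in>conn_domain Q G l N. \<exists>!g. g \<in> carrier G \<and> (q0, l (inv\<^bsub>G\<^esub> g) q1) \<in> Hor \<inter> U) \<and>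
     smooth_map_on (prod_mfd Q Q) MG (conn_domain Q G l N) (disc_conn G l Hor U)"

definition chaplygin_symmetry_group ::
  "('g, 'f::real_normed_vector) mfd \<Rightarrow> ('g, 'z) monoid_scheme \<Rightarrow> ('g \<Rightarrow> 'q \<Rightarrow> 'q) \<Rightarrow>
   ('q set, 'h::real_normed_vector) mfd \<Rightarrow>
   ('q, 'e::real_normed_vector) mfd \<Rightarrow> ('q \<times> 'q \<Rightarrow> real) \<Rightarrow> ('q \<Rightarrow> 'e set) \<Rightarrow> ('q \<times> 'q) set \<Rightarrow>
   ('q \<Rightarrow> 'g) \<Rightarrow> bool" where
  "chaplygin_symmetry_group MG G l B Q L D Dd \<gamma> \<longleftrightarrow>
     symmetry_group MG G l B Q L D Dd \<and>
     (\<forall>q\<in>pts Q. direct_sum (vertical_space Q G l q) (D q)) \<and>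
     affine_discrete_connection Q MG G l \<gamma> Dd"

text \<open>The horizontal lift of the principal connection with horizontal bundle \<open>D\<close>.\<close>

definition hor_lift ::
  "('q, 'e::real_normed_vector) mfd \<Rightarrow> ('g, 'z) monoid_scheme \<Rightarrow> ('g \<Rightarrow> 'q \<Rightarrow> 'q) \<Rightarrow>
   ('q set, 'h::real_normed_vector) mfd \<Rightarrow> ('q \<Rightarrow> 'e set) \<Rightarrow> 'q \<Rightarrow> 'h \<Rightarrow> 'e" where
  "hor_lift Q G l B D q \<delta>r = (THE v. v \<in> D q \<and> mfderiv Q B (orbit G l) q v = \<delta>r)"

text \<open>The horizontal lift \<open>hb q0 r1\<close> of the discrete connection \<open>Ad\<close>.\<close>

definition disc_hor_lift ::
  "('q, 'e) mfd \<Rightarrow> ('g, 'z) monoid_scheme \<Rightarrow> ('g \<Rightarrow> 'q \<Rightarrow> 'q) \<Rightarrow> ('q \<times> 'q \<Rightarrow> 'g) \<Rightarrow> 'q \<Rightarrow> 'q set \<Rightarrow> 'q" where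
  "disc_hor_lift Q G l Ad q0 r1 =
     (THE q1. q1 \<in> pts Q \<and> orbit G l q1 = r1 \<and> Ad (q0, q1) = \<one>\<^bsub>G\<^esub>)"


section \<open>Discrete curves and reduced objects\<close>

definition disc_action :: "('a \<times> 'a \<Rightarrow> real) \<Rightarrow> nat \<Rightarrow> (nat \<Rightarrow> 'a) \<Rightarrow> real" where
  "disc_action L N q = (\<Sum>k<N. L (q k, q (Suc k)))"

text \<open>The differential of a function \<open>S\<close> of discrete curves, i.e. on a product of copies of \<open>M\<close>,
  evaluated at a variation: its directional derivative in the product of the preferred charts.\<close>

definition curve_differential :: "('a, 'e::real_normed_vector) mfd \<Rightarrow> ((nat \<Rightarrow> 'a) \<Rightarrow> real) \<Rightarrow>
    (nat \<Rightarrow> 'a) \<Rightarrow> (nat \<Rightarrow> 'e) \<Rightarrow> real" where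
  "curve_differential M S q \<delta>q =
     deriv (\<lambda>t. S (\<lambda>k. chart_inv M (q k) (chart_map M (q k) (q k) + t *\<^sub>R \<delta>q k))) 0"

text \<open>The class \<open>\<rho> (q, w)\<close> in \<open>(Q \<times> G)/G\<close>, as an orbit.\<close>

definition rho :: "('g, 'z) monoid_scheme \<Rightarrow> ('g \<Rightarrow> 'q \<Rightarrow> 'q) \<Rightarrow> 'q \<times> 'g \<Rightarrow> ('q \<times> 'g) set" where
  "rho G l = orbit G (\<lambda>g (q, w). (l g q, g \<otimes>\<^bsub>G\<^esub> w \<otimes>\<^bsub>G\<^esub> inv\<^bsub>G\<^esub> g))"

definition F1_tilde :: "('g \<Rightarrow> 'q \<Rightarrow> 'q) \<Rightarrow> ('q \<Rightarrow> 'q set \<Rightarrow> 'q) \<Rightarrow> 'q \<Rightarrow> 'g \<Rightarrow> 'q set \<Rightarrow> 'q" where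
  "F1_tilde l hb q0 w0 r1 = l w0 (hb q0 r1)"

definition check_L :: "('g \<Rightarrow> 'q \<Rightarrow> 'q) \<Rightarrow> ('q \<times> 'q \<Rightarrow> real) \<Rightarrow> ('q \<Rightarrow> 'q set \<Rightarrow> 'q) \<Rightarrow>
    'q \<Rightarrow> 'g \<Rightarrow> 'q set \<Rightarrow> real" where
  "check_L l L hb q0 w0 r1 = L (q0, F1_tilde l hb q0 w0 r1)"

text \<open>The maps on \<open>(Q \<times> G)/G \<times> Q/G\<close> are independent of the representative \<open>(q0, w0)\<close> of
  the class \<open>v0\<close>; the definitions pick one.\<close>

definition hat_L :: "('g \<Rightarrow> 'q \<Rightarrow> 'q) \<Rightarrow> ('q \<times> 'q \<Rightarrow> real) \<Rightarrow> ('q \<Rightarrow> 'q set \<Rightarrow> 'q) \<Rightarrow>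
    ('q \<times> 'g) set \<times> 'q set \<Rightarrow> real" where
  "hat_L l L hb = (\<lambda>(v0, r1). let (q0, w0) = (SOME x. x \<in> v0) in check_L l L hb q0 w0 r1)"

definition hat_F_plus ::
  "('q, 'e::real_normed_vector) mfd \<Rightarrow> ('g, 'f::real_normed_vector) mfd \<Rightarrow> ('g \<Rightarrow> 'q \<Rightarrow> 'q) \<Rightarrow>
   ('q \<times> 'q \<Rightarrow> real) \<Rightarrow> ('q \<times> 'q \<Rightarrow> 'g) \<Rightarrow> ('q \<Rightarrow> 'q set \<Rightarrow> 'q) \<Rightarrow> ('q \<Rightarrow> 'h \<Rightarrow> 'e) \<Rightarrow>
   ('q \<times> 'g) set \<times> 'q set \<Rightarrow> 'h \<Rightarrow> real" where
  "hat_F_plus Q MG l L Ad hb h = (\<lambda>(v0, r1) \<delta>r1.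
     let (q0, w0) = (SOME x. x \<in> v0); q1 = F1_tilde l hb q0 w0 r1
     in mfderiv MG real_mfd (\<lambda>w. check_L l L hb q0 w r1) w0
          (partial2 Q MG Ad (q0, q1) (h q1 \<delta>r1)))"

definition hat_F_minus ::
  "('q, 'e::real_normed_vector) mfd \<Rightarrow> ('g, 'f::real_normed_vector) mfd \<Rightarrow> ('g \<Rightarrow> 'q \<Rightarrow> 'q) \<Rightarrow>
   ('q \<times> 'q \<Rightarrow> real) \<Rightarrow> ('q \<times> 'q \<Rightarrow> 'g) \<Rightarrow> ('q \<Rightarrow> 'q set \<Rightarrow> 'q) \<Rightarrow> ('q \<Rightarrow> 'h \<Rightarrow> 'e) \<Rightarrow>
   ('q \<times> 'g) set \<times> 'q set \<Rightarrow> 'h \<Rightarrow> real" where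
  "hat_F_minus Q MG l L Ad hb h = (\<lambda>(v0, r1) \<delta>r0.
     let (q0, w0) = (SOME x. x \<in> v0); q1 = F1_tilde l hb q0 w0 r1
     in mfderiv MG real_mfd (\<lambda>w. check_L l L hb q0 w r1) w0
          (partial1 Q MG Ad (q0, q1) (h q0 \<delta>r0)))"

text \<open>The fibre of the projection over an orbit \<open>r0\<close> is \<open>r0\<close> itself.\<close>

definition upsilon :: "('g, 'z) monoid_scheme \<Rightarrow> ('g \<Rightarrow> 'q \<Rightarrow> 'q) \<Rightarrow>
    'q set \<times> 'q set \<Rightarrow> ('q \<times> 'g) set \<times> 'q set" where
  "upsilon G l = (\<lambda>(r0, r1). (rho G l (SOME q0. q0 \<in> r0, \<one>\<^bsub>G\<^esub>), r1))"

definition breve_L ::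
  "('g, 'z) monoid_scheme \<Rightarrow> ('g \<Rightarrow> 'q \<Rightarrow> 'q) \<Rightarrow> ('q \<times> 'q \<Rightarrow> real) \<Rightarrow> ('q \<Rightarrow> 'q set \<Rightarrow> 'q) \<Rightarrow>
   'q set \<times> 'q set \<Rightarrow> real" where
  "breve_L G l L hb = hat_L l L hb \<circ> upsilon G l"

definition breve_F_plus ::
  "('q, 'e::real_normed_vector) mfd \<Rightarrow> ('g, 'f::real_normed_vector) mfd \<Rightarrow> ('g, 'z) monoid_scheme \<Rightarrow>
   ('g \<Rightarrow> 'q \<Rightarrow> 'q) \<Rightarrow> ('q \<times> 'q \<Rightarrow> real) \<Rightarrow> ('q \<times> 'q \<Rightarrow> 'g) \<Rightarrow> ('q \<Rightarrow> 'q set \<Rightarrow> 'q) \<Rightarrow>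
   ('q \<Rightarrow> 'h \<Rightarrow> 'e) \<Rightarrow> 'q set \<times> 'q set \<Rightarrow> 'h \<Rightarrow> real" where
  "breve_F_plus Q MG G l L Ad hb h = hat_F_plus Q MG l L Ad hb h \<circ> upsilon G l"

definition breve_F_minus ::
  "('q, 'e::real_normed_vector) mfd \<Rightarrow> ('g, 'f::real_normed_vector) mfd \<Rightarrow> ('g, 'z) monoid_scheme \<Rightarrow>
   ('g \<Rightarrow> 'q \<Rightarrow> 'q) \<Rightarrow> ('q \<times> 'q \<Rightarrow> real) \<Rightarrow> ('q \<times> 'q \<Rightarrow> 'g) \<Rightarrow> ('q \<Rightarrow> 'q set \<Rightarrow> 'q) \<Rightarrow>
   ('q \<Rightarrow> 'h \<Rightarrow> 'e) \<Rightarrow> 'q set \<times> 'q set \<Rightarrow> 'h \<Rightarrow> real" where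
  "breve_F_minus Q MG G l L Ad hb h = hat_F_minus Q MG l L Ad hb h \<circ> upsilon G l"

end

theory Submission
  imports Defs
begin

text \<open>
  On pairs of points of \<open>Q\<close> the reduced Lagrangian satisfies
  \<open>Lb (\<pi> x, \<pi> y) = L (x, l (inv (Ad (x, y))) y)\<close> (\<open>Lb_proj\<close>): the discrete horizontal lift moves \<open>y\<close>
  back along its orbit by \<open>Ad (x, y)\<close>. Along the given curve \<open>Ad\<close> has the value \<open>e\<close>, and inversion has
  the derivative \<open>-1\<close> at \<open>e\<close>. Differentiating at such a pair \<open>(a, b)\<close> in directions \<open>v\<close>, \<open>w\<close> gives
  \<open>dLb (d\<pi> v, d\<pi> w) = dL (v, w) - D\<^sub>2L (\<Lambda> (dAd (v, w)))\<close>, where \<open>\<Lambda>\<close> is the infinitesimal action at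
  \<open>b\<close>. The subtracted term is the sum of the forces when \<open>v\<close> and \<open>w\<close> are horizontal lifts. Hence the
  partial derivatives of \<open>Lb\<close> plus the forces are those of \<open>L\<close> along horizontal lifts
  (\<open>reduced_derivative\<close>, \<open>reduced_partials\<close>).

  The horizontal lift at \<open>q\<close> is a linear bijection from the tangent space of the orbit space onto
  \<open>D q\<close>. This uses that the kernel of \<open>d\<pi>\<close> is the vertical space, defined by velocities of smooth
  curves in orbits (\<open>vertical_in_kernel\<close>, \<open>kernel_vertical\<close>). So \<open>D\<^sub>1L + D\<^sub>2L\<close> vanishes on \<open>D\<close> at the
  index \<open>k\<close> if and only if the reduced equation holds there, which is the equivalence of (2) and (4).

  The equivalences of (1) with (2) and of (3) with (4) are the usual passage between a variational
  principle and its Euler--Lagrange equations: the differential of the action is a sum over the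
  interior indices (\<open>curve_differential_vanishing_ends\<close>), and a variation supported at one index
  isolates one summand (\<open>variations_vanish_iff\<close>).
\<close>

section \<open>Differential calculus in charts\<close>

text \<open>
  The derivative is taken in two explicitly given charts. The preferred chart of a product manifold
  at a point is an arbitrary product of charts, with no relation to the preferred charts of the
  factors, so that \<open>mfderiv\<close> on a product cannot be compared with partial derivatives; the product
  of the preferred charts of the factors can. The middle clause says that \<open>f\<close> stays in the target
  chart near \<open>p\<close>, without which the coordinates of \<open>f\<close> carry no information about \<open>f\<close> and the
  chain rule fails.
\<close>

definition has_chart_derivative ::
  "('a, 'e::real_normed_vector) chart \<Rightarrow> ('b, 'f::real_normed_vector) chart \<Rightarrow> ('a \<Rightarrow> 'b) \<Rightarrow> 'a \<Rightarrow>
   ('e \<Rightarrow> 'f) \<Rightarrow> bool" where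
  "has_chart_derivative K1 K2 f p f' \<longleftrightarrow> p \<in> fst K1 \<and>
     (\<forall>\<^sub>F x in nhds (snd K1 p). f (inv_into (fst K1) (snd K1) x) \<in> fst K2) \<and>
     ((\<lambda>x. snd K2 (f (inv_into (fst K1) (snd K1) x))) has_derivative f') (at (snd K1 p))"

text \<open>
  The part of the notion of a chart on which the calculus rests: injectivity, and open images of
  open sets. In this form a product of charts inherits it by an argument on open boxes.
\<close>

definition chart_set :: "('a, 'e::real_normed_vector) mfd \<Rightarrow> ('a, 'e) chart set" where
  "chart_set M = {K. openin (topo M) (fst K) \<and> inj_on (snd K) (fst K) \<and>
     (\<forall>W. openin (topo M) W \<and> W \<subseteq> fst K \<longrightarrow> open (snd K ` W))}"

definition prod_chart :: "('a, 'e) chart \<Rightarrow> ('b, 'f) chart \<Rightarrow> ('a \<times> 'b, 'e \<times> 'f) chart" where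
  "prod_chart K1 K2 = (fst K1 \<times> fst K2, map_prod (snd K1) (snd K2))"

lemma has_derivative_cong_nhds:
  assumes "(f has_derivative f') (at x)" "\<forall>\<^sub>F y in nhds x. f y = g y"
  shows "(g has_derivative f') (at x)"
proof -
  obtain S where "open S" "x \<in> S" "\<And>y. y \<in> S \<Longrightarrow> f y = g y"
    using assms(2) unfolding eventually_nhds by blast
  then show ?thesis
    using has_derivative_transform_within_open[OF assms(1)] by blast
qed

lemma chart_setD:
  assumes "K \<in> chart_set M"
  shows "openin (topo M) (fst K)" "inj_on (snd K) (fst K)" "open (snd K ` fst K)"
    "p \<in> fst K \<Longrightarrow> inv_into (fst K) (snd K) (snd K p) = p"
  using assms by (auto simp: chart_set_def)

text \<open>
  Carries a property that holds on an open set of the manifold over to all coordinates near those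
  of \<open>p\<close>.
\<close>

lemma eventually_chart_nhds:
  assumes K: "K \<in> chart_set M" and "openin (topo M) A" "p \<in> A" "p \<in> fst K"
    and P: "\<And>x. x \<in> A \<Longrightarrow> x \<in> fst K \<Longrightarrow> P x (snd K x)"
  shows "\<forall>\<^sub>F x in nhds (snd K p). P (inv_into (fst K) (snd K) x) x"
proof -
  have "open (snd K ` (A \<inter> fst K))"
    using assms by (auto simp: chart_set_def)
  moreover have "P (inv_into (fst K) (snd K) y) y" if "y \<in> snd K ` (A \<inter> fst K)" for y
    using that P chart_setD(4)[OF K] by auto
  ultimately show ?thesis
    using assms(3,4) unfolding eventually_nhds by blast
qed

lemma has_chart_derivative_linear:
  "has_chart_derivative K1 K2 f p f' \<Longrightarrow> linear f'"
  unfolding has_chart_derivative_def using has_derivative_linear by blast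

lemma has_chart_derivative_unique:
  assumes "has_chart_derivative K1 K2 f p f'" "has_chart_derivative K1 K2 f p f''"
  shows "f' = f''"
  using assms has_derivative_unique unfolding has_chart_derivative_def by blast

text \<open>
  The chain rule: near \<open>p\<close> the map \<open>f\<close> takes values in the middle chart, so there the coordinate
  expression of \<open>g \<circ> f\<close> is the composition of the two coordinate expressions.
\<close>

lemma has_chart_derivative_compose:
  assumes inj: "inj_on (snd K1) (fst K1)" "inj_on (snd K2) (fst K2)"
    and f: "has_chart_derivative K1 K2 f p f'"
    and g: "has_chart_derivative K2 K3 g (f p) g'"
  shows "has_chart_derivative K1 K3 (\<lambda>x. g (f x)) p (\<lambda>v. g' (f' v))"
proof -
  let ?i1 = "inv_into (fst K1) (snd K1)" and ?i2 = "inv_into (fst K2) (snd K2)"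
  define F where "F = (\<lambda>x. snd K2 (f (?i1 x)))"
  have p: "p \<in> fst K1" "?i1 (snd K1 p) = p"
    using f inj by (auto simp: has_chart_derivative_def)
  have Fp: "F (snd K1 p) = snd K2 (f p)" by (simp add: F_def p)
  have dF: "(F has_derivative f') (at (snd K1 p))"
    using f unfolding F_def has_chart_derivative_def by simp
  have tF: "filterlim F (nhds (snd K2 (f p))) (nhds (snd K1 p))"
    using has_derivative_continuous[OF dF] Fp tendsto_at_iff_tendsto_nhds
    by (metis continuous_within)
  have ev: "\<forall>\<^sub>F x in nhds (snd K1 p). ?i2 (F x) = f (?i1 x)"
    using f inj(2) unfolding has_chart_derivative_def F_def
    by (auto elim!: eventually_mono)
  have "\<forall>\<^sub>F x in nhds (snd K1 p). g (?i2 (F x)) \<in> fst K3"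
    using g tF unfolding has_chart_derivative_def filterlim_iff by blast
  with ev have 1: "\<forall>\<^sub>F x in nhds (snd K1 p). g (f (?i1 x)) \<in> fst K3"
    by eventually_elim simp
  have "((\<lambda>y. snd K3 (g (?i2 y))) \<circ> F has_derivative g' \<circ> f') (at (snd K1 p))"
    using g dF unfolding has_chart_derivative_def by (intro diff_chain_at) (auto simp: Fp)
  then have "((\<lambda>x. snd K3 (g (f (?i1 x)))) has_derivative g' \<circ> f') (at (snd K1 p))"
    by (rule has_derivative_cong_nhds) (use ev in \<open>auto elim!: eventually_mono\<close>)
  with 1 p show ?thesis by (simp add: has_chart_derivative_def o_def)
qed

lemma has_chart_derivative_cong:
  assumes "K1 \<in> chart_set M" "openin (topo M) A" "p \<in> A" "\<And>x. x \<in> A \<Longrightarrow> f x = g x"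
    "has_chart_derivative K1 K2 f p f'"
  shows "has_chart_derivative K1 K2 g p f'"
proof -
  have ev: "\<forall>\<^sub>F x in nhds (snd K1 p).
      f (inv_into (fst K1) (snd K1) x) = g (inv_into (fst K1) (snd K1) x)"
    by (rule eventually_chart_nhds[OF assms(1-3), where P = "\<lambda>x y. f x = g x"])
      (use assms in \<open>auto simp: has_chart_derivative_def\<close>)
  have "\<forall>\<^sub>F x in nhds (snd K1 p). g (inv_into (fst K1) (snd K1) x) \<in> fst K2"
    using assms(5) ev unfolding has_chart_derivative_def
    by (auto elim: eventually_elim2)
  moreover have "((\<lambda>x. snd K2 (g (inv_into (fst K1) (snd K1) x))) has_derivative f') (at (snd K1 p))"
    by (rule has_derivative_cong_nhds[where f = "\<lambda>x. snd K2 (f (inv_into (fst K1) (snd K1) x))"])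
      (use assms(5) ev in \<open>auto simp: has_chart_derivative_def elim: eventually_mono\<close>)
  ultimately show ?thesis
    using assms(5) by (simp add: has_chart_derivative_def)
qed

lemma has_chart_derivative_id:
  assumes "K \<in> chart_set M" "p \<in> fst K"
  shows "has_chart_derivative K K (\<lambda>x. x) p (\<lambda>v. v)"
proof -
  have "\<forall>\<^sub>F x in nhds (snd K p). inv_into (fst K) (snd K) x \<in> fst K"
    by (rule eventually_chart_nhds[OF assms(1) chart_setD(1)[OF assms(1)], where P = "\<lambda>x _. x \<in> fst K"])
      (use assms in auto)
  moreover have "\<forall>\<^sub>F x in nhds (snd K p). x = snd K (inv_into (fst K) (snd K) x)"
    by (rule eventually_chart_nhds[OF assms(1) chart_setD(1)[OF assms(1)], where P = "\<lambda>x y. y = snd K x"])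
      (use assms in auto)
  ultimately show ?thesis
    unfolding has_chart_derivative_def
    by (intro conjI has_derivative_cong_nhds[OF has_derivative_ident] assms(2))
qed

lemma has_chart_derivative_const:
  assumes "p \<in> fst K1" "c \<in> fst K2"
  shows "has_chart_derivative K1 K2 (\<lambda>x. c) p (\<lambda>v. 0)"
  using assms by (simp add: has_chart_derivative_def)

lemma has_chart_derivative_Pair:
  assumes "has_chart_derivative K K1 f p f'" "has_chart_derivative K K2 g p g'"
  shows "has_chart_derivative K (prod_chart K1 K2) (\<lambda>x. (f x, g x)) p (\<lambda>v. (f' v, g' v))"
  using assms unfolding has_chart_derivative_def prod_chart_def
  by (auto intro: has_derivative_Pair eventually_conj)

text \<open>
  Both the domain and the coordinate map are products, and an open subset of the domain is a union
  of open boxes, each of which has an open image.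
\<close>

lemma chart_set_prod:
  assumes K: "K1 \<in> chart_set M1" "K2 \<in> chart_set M2"
  shows "prod_chart K1 K2 \<in> chart_set (prod_mfd M1 M2)"
proof -
  have "open (map_prod (snd K1) (snd K2) ` W)"
    if W: "openin (prod_topology (topo M1) (topo M2)) W" "W \<subseteq> fst K1 \<times> fst K2" for W
  proof (subst open_subopen, intro ballI)
    fix z assume "z \<in> map_prod (snd K1) (snd K2) ` W"
    then obtain x y where xy: "(x, y) \<in> W" "z = (snd K1 x, snd K2 y)" by auto
    then obtain S T where ST: "openin (topo M1) S" "openin (topo M2) T" "x \<in> S" "y \<in> T" "S \<times> T \<subseteq> W"
      using W(1)[unfolded openin_prod_topology_alt, rule_format, OF xy(1)] by auto
    have "S \<times> T \<subseteq> fst K1 \<times> fst K2" using ST(5) W(2) by (rule subset_trans)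
    then have "S \<subseteq> fst K1" "T \<subseteq> fst K2" using ST(3,4) times_subset_iff by auto
    then have "open (snd K1 ` S \<times> snd K2 ` T)"
      using K ST by (intro open_Times) (auto simp: chart_set_def)
    moreover have "snd K1 ` S \<times> snd K2 ` T \<subseteq> map_prod (snd K1) (snd K2) ` W"
      using image_mono[OF ST(5), of "map_prod (snd K1) (snd K2)"] by (simp add: map_prod_surj_on)
    moreover have "z \<in> snd K1 ` S \<times> snd K2 ` T" using xy ST by simp
    ultimately show "\<exists>T. open T \<and> z \<in> T \<and> T \<subseteq> map_prod (snd K1) (snd K2) ` W" by blast
  qed
  moreover have "openin (prod_topology (topo M1) (topo M2)) (fst K1 \<times> fst K2)"
    using K by (simp add: openin_prod_Times_iff chart_set_def)
  moreover have "inj_on (map_prod (snd K1) (snd K2)) (fst K1 \<times> fst K2)"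
    using K by (intro map_prod_inj_on) (simp_all add: chart_set_def)
  ultimately show ?thesis
    by (simp add: chart_set_def prod_chart_def prod_mfd_def)
qed

lemma has_chart_derivative_fst_snd:
  assumes K: "K1 \<in> chart_set M1" "K2 \<in> chart_set M2" and p: "p1 \<in> fst K1" "p2 \<in> fst K2"
  shows "has_chart_derivative (prod_chart K1 K2) K1 fst (p1, p2) fst"
    and "has_chart_derivative (prod_chart K1 K2) K2 snd (p1, p2) snd"
proof -
  note id = has_chart_derivative_id[OF chart_set_prod[OF K], of "(p1, p2)"]
  have inj: "inj_on (snd (prod_chart K1 K2)) (fst (prod_chart K1 K2))"
    using chart_setD(2)[OF chart_set_prod[OF K]] .
  let ?i = "inv_into (fst (prod_chart K1 K2)) (snd (prod_chart K1 K2))"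
  let ?x = "snd (prod_chart K1 K2) (p1, p2)"
  have ev: "\<forall>\<^sub>F x in nhds ?x. P (?i x) x"
    if "\<And>z. z \<in> fst K1 \<times> fst K2 \<Longrightarrow> P z (snd (prod_chart K1 K2) z)" for P
    by (rule eventually_chart_nhds[OF chart_set_prod[OF K] chart_setD(1)[OF chart_set_prod[OF K]]])
      (use p that in \<open>auto simp: prod_chart_def\<close>)
  have ev1: "\<forall>\<^sub>F x in nhds ?x. fst (?i x) \<in> fst K1" "\<forall>\<^sub>F x in nhds ?x. snd (?i x) \<in> fst K2"
    by (rule ev; auto)+
  have ev2: "\<forall>\<^sub>F x in nhds ?x. fst x = snd K1 (fst (?i x))"
    "\<forall>\<^sub>F x in nhds ?x. snd x = snd K2 (snd (?i x))"
    by (rule ev; auto simp: prod_chart_def)+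
  have "((\<lambda>x. snd K1 (fst (?i x))) has_derivative fst) (at ?x)"
    by (rule has_derivative_cong_nhds[OF has_derivative_fst[OF has_derivative_ident] ev2(1)])
  moreover have "((\<lambda>x. snd K2 (snd (?i x))) has_derivative snd) (at ?x)"
    by (rule has_derivative_cong_nhds[OF has_derivative_snd[OF has_derivative_ident] ev2(2)])
  moreover note ev1
  moreover have "(p1, p2) \<in> fst (prod_chart K1 K2)"
    using p by (simp add: prod_chart_def)
  ultimately show "has_chart_derivative (prod_chart K1 K2) K1 fst (p1, p2) fst"
    "has_chart_derivative (prod_chart K1 K2) K2 snd (p1, p2) snd"
    unfolding has_chart_derivative_def by blast+
qed

lemma has_chart_derivative_prod_map:
  assumes K: "K1 \<in> chart_set M1" "K2 \<in> chart_set M2" and p: "p1 \<in> fst K1" "p2 \<in> fst K2"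
    and f: "has_chart_derivative K1 H1 f p1 f'" and g: "has_chart_derivative K2 H2 g p2 g'"
  shows "has_chart_derivative (prod_chart K1 K2) (prod_chart H1 H2) (\<lambda>z. (f (fst z), g (snd z))) (p1, p2)
    (\<lambda>v. (f' (fst v), g' (snd v)))"
proof (rule has_chart_derivative_Pair)
  note inj = chart_setD(2)[OF chart_set_prod[OF K]]
  show "has_chart_derivative (prod_chart K1 K2) H1 (\<lambda>z. f (fst z)) (p1, p2) (\<lambda>v. f' (fst v))"
    by (rule has_chart_derivative_compose[OF inj chart_setD(2)[OF K(1)] has_chart_derivative_fst_snd(1)[OF K p]])
      (use f in simp)
  show "has_chart_derivative (prod_chart K1 K2) H2 (\<lambda>z. g (snd z)) (p1, p2) (\<lambda>v. g' (snd v))"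
    by (rule has_chart_derivative_compose[OF inj chart_setD(2)[OF K(2)] has_chart_derivative_fst_snd(2)[OF K p]])
      (use g in simp)
qed

section \<open>Derivatives of maps between manifolds\<close>

lemma chart_at_atlas:
  assumes "smooth_manifold M" "p \<in> pts M"
  shows "chart_at M p \<in> atlas M" "p \<in> fst (chart_at M p)"
proof -
  have "p \<in> \<Union> (fst ` atlas M)" using assms by (simp add: smooth_manifold_def)
  then have "\<exists>c. c \<in> atlas M \<and> p \<in> fst c" by blast
  from someI_ex[OF this] show "chart_at M p \<in> atlas M" "p \<in> fst (chart_at M p)"
    by (simp_all add: chart_at_def)
qed

lemma is_chart_chart_set:
  assumes "is_chart M K"
  shows "K \<in> chart_set M"
proof -
  obtain U \<phi> where K: "K = (U, \<phi>)" by (cases K)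
  have U: "openin (topo M) U" "open (\<phi> ` U)"
    and hom: "homeomorphic_map (subtopology (topo M) U) (top_of_set (\<phi> ` U)) \<phi>"
    using assms by (auto simp: is_chart_def K)
  have ts: "topspace (subtopology (topo M) U) = U"
    using U(1) openin_subset by fastforce
  have "inj_on \<phi> U" using hom ts by (simp add: homeomorphic_eq_everything_map)
  moreover have "open (\<phi> ` W)" if "openin (topo M) W" "W \<subseteq> U" for W
  proof -
    have "openin (subtopology (topo M) U) W"
      using that U(1) by (simp add: openin_open_subtopology)
    then have "openin (top_of_set (\<phi> ` U)) (\<phi> ` W)"
      using hom by (auto simp: homeomorphic_eq_everything_map open_map_def)
    then show ?thesis using U(2) openin_open_trans by blast
  qed
  ultimately show ?thesis using U by (simp add: chart_set_def K)
qed

lemma chart_at_is_chart: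
  assumes "smooth_manifold M" "p \<in> pts M"
  shows "is_chart M (chart_at M p)" "chart_at M p \<in> chart_set M"
    "inj_on (snd (chart_at M p)) (fst (chart_at M p))"
proof -
  show "is_chart M (chart_at M p)"
    using chart_at_atlas(1)[OF assms] assms(1) by (simp add: smooth_manifold_def smooth_chart_def)
  then show "chart_at M p \<in> chart_set M"
    by (rule is_chart_chart_set)
  then show "inj_on (snd (chart_at M p)) (fst (chart_at M p))"
    by (rule chart_setD)
qed

lemma real_chart:
  "chart_at real_mfd x = (UNIV, id)" "(UNIV, id) \<in> chart_set real_mfd"
  unfolding chart_at_def by (rule some_equality) (auto simp: real_mfd_def chart_set_def)

lemma smooth_manifold_real_mfd: "smooth_manifold real_mfd"
proof -
  have const: "Ck_on k S (\<lambda>x. c)" for k and S :: "real set" and c :: real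
    by (induction k arbitrary: c) auto
  have "Ck_on k UNIV (\<lambda>x::real. x)" for k
    by (cases k) (simp_all add: const)
  then have "smooth_chart real_mfd (UNIV, id)"
    using homeomorphic_map_id[of euclideanreal euclideanreal]
    by (simp add: smooth_chart_def is_chart_def smooth_transition_def smooth_on_def real_mfd_def
        inv_id id_def o_def)
  moreover have "\<exists>b::real set. finite b \<and> span b = UNIV"
    by (intro exI[of _ Basis] conjI finite_Basis span_Basis)
  moreover have "second_countable euclideanreal"
    unfolding second_countable_def
    using ex_countable_basis[where 'a = real] topological_basis_open topological_basisE
    by (metis open_openin)
  ultimately show ?thesis
    unfolding smooth_manifold_def by (simp add: real_mfd_def)
qed

lemma prod_chart_atlas:
  "K1 \<in> atlas M1 \<Longrightarrow> K2 \<in> atlas M2 \<Longrightarrow> prod_chart K1 K2 \<in> atlas (prod_mfd M1 M2)"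
  by (cases K1; cases K2) (auto simp: prod_mfd_def prod_chart_def)

text \<open>
  Differentiability is the first stage of \<open>Ck_on\<close>; continuity of \<open>f\<close> keeps the values in the target
  chart.
\<close>

lemma smooth_map_on_has_chart_derivative:
  assumes f: "smooth_map_on M N A f"
    and K1: "K1 \<in> atlas M" "K1 \<in> chart_set M" and K2: "K2 \<in> atlas N" "K2 \<in> chart_set N"
    and p: "p \<in> A" "p \<in> fst K1" "f p \<in> fst K2"
  shows "\<exists>f'. has_chart_derivative K1 K2 f p f'"
proof -
  obtain U \<phi> V \<psi> where K: "K1 = (U, \<phi>)" "K2 = (V, \<psi>)" by (cases K1; cases K2)
  have A: "openin (topo M) A" and cont: "continuous_map (subtopology (topo M) A) (topo N) f"
    and "smooth_on (\<phi> ` {p \<in> A \<inter> U. f p \<in> V}) (\<psi> \<circ> f \<circ> inv_into U \<phi>)"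
    using f K1(1) K2(1) by (auto simp: smooth_map_on_def K)
  then have "Ck_on (Suc 0) (\<phi> ` {p \<in> A \<inter> U. f p \<in> V}) (\<psi> \<circ> f \<circ> inv_into U \<phi>)"
    unfolding smooth_on_def by blast
  then have "(\<psi> \<circ> f \<circ> inv_into U \<phi>) differentiable (at (\<phi> p))"
    using p by (auto simp: K)
  then obtain f' where f': "((\<lambda>x. \<psi> (f (inv_into U \<phi> x))) has_derivative f') (at (\<phi> p))"
    by (auto simp: differentiable_def o_def)
  have "openin (topo M) {x \<in> A. f x \<in> V}"
  proof -
    have "topspace (subtopology (topo M) A) = A" using A openin_subset by fastforce
    then have "openin (subtopology (topo M) A) {x \<in> A. f x \<in> V}"
      using cont chart_setD(1)[OF K2(2)] by (auto simp: continuous_map K dest: openin_continuous_map_preimage)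
    then show ?thesis using A openin_trans_full by blast
  qed
  then have "\<forall>\<^sub>F x in nhds (\<phi> p). f (inv_into U \<phi> x) \<in> V"
    by (rule eventually_chart_nhds[OF K1(2), where P = "\<lambda>x y. f x \<in> V", unfolded K fst_conv snd_conv])
      (use p in \<open>simp_all add: K\<close>)
  then have "has_chart_derivative K1 K2 f p f'"
    using f' p by (simp add: has_chart_derivative_def K)
  then show ?thesis by (rule exI[where x = f'])
qed

lemma mfderiv_eq:
  assumes "has_chart_derivative (chart_at M p) (chart_at N (f p)) f p f'"
  shows "mfderiv M N f p = f'"
  unfolding mfderiv_def chart_map_def chart_inv_def o_def
  using assms by (intro frechet_derivative_at[symmetric]) (simp add: has_chart_derivative_def)

text \<open>
  A partial derivative is the derivative along the inclusion of a factor, whose derivative is the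
  inclusion of that factor of the model space.
\<close>

lemma partial_eq:
  assumes M: "smooth_manifold M1" "smooth_manifold M2" "a \<in> pts M1" "b \<in> pts M2"
    and f: "has_chart_derivative (prod_chart (chart_at M1 a) (chart_at M2 b)) (chart_at N (f (a, b))) f (a, b) f'"
  shows "partial1 M1 N f (a, b) = (\<lambda>v. f' (v, 0))" "partial2 M2 N f (a, b) = (\<lambda>v. f' (0, v))"
proof -
  note K1 = chart_at_is_chart[OF M(1,3)] chart_at_atlas[OF M(1,3)]
  note K2 = chart_at_is_chart[OF M(2,4)] chart_at_atlas[OF M(2,4)]
  note inj = chart_setD(2)[OF chart_set_prod[OF K1(2) K2(2)]]
  have "has_chart_derivative (chart_at M1 a) (chart_at N (f (a, b))) (\<lambda>x. f (x, b)) a (\<lambda>v. f' (v, 0))"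
    by (rule has_chart_derivative_compose[OF K1(3) inj has_chart_derivative_Pair[OF
          has_chart_derivative_id[OF K1(2,5)] has_chart_derivative_const[OF K1(5) K2(5)]] f])
  from mfderiv_eq[OF this] show "partial1 M1 N f (a, b) = (\<lambda>v. f' (v, 0))"
    by (simp add: partial1_def)
  have "has_chart_derivative (chart_at M2 b) (chart_at N (f (a, b))) (\<lambda>x. f (a, x)) b (\<lambda>v. f' (0, v))"
    by (rule has_chart_derivative_compose[OF K2(3) inj has_chart_derivative_Pair[OF
          has_chart_derivative_const[OF K2(5) K1(5)] has_chart_derivative_id[OF K2(2,5)]] f])
  from mfderiv_eq[OF this] show "partial2 M2 N f (a, b) = (\<lambda>v. f' (0, v))"
    by (simp add: partial2_def)
qed

text \<open>
  The straight coordinate line through \<open>p\<close> in direction \<open>v\<close>: the curve along which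
  \<open>curve_differential\<close> differentiates, and from which vertical curves are made.
\<close>

lemma has_chart_derivative_line:
  assumes K: "K \<in> chart_set M" and p: "p \<in> fst K"
  shows "has_chart_derivative (UNIV, id) K
    (\<lambda>t::real. inv_into (fst K) (snd K) (snd K p + t *\<^sub>R v)) 0 (\<lambda>t. t *\<^sub>R v)"
proof -
  have "((\<lambda>t::real. snd K p + t *\<^sub>R v) \<longlongrightarrow> snd K p + 0 *\<^sub>R v) (nhds 0)"
    by (intro tendsto_intros filterlim_ident)
  then have ev: "\<forall>\<^sub>F t in nhds (0::real). snd K p + t *\<^sub>R v \<in> snd K ` fst K"
    using chart_setD(3)[OF K] p by (auto simp: tendsto_def)
  have "((\<lambda>t::real. snd K p + t *\<^sub>R v) has_derivative (\<lambda>t. t *\<^sub>R v)) (at 0)"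
    by (auto intro!: derivative_eq_intros)
  then have "((\<lambda>t::real. snd K (inv_into (fst K) (snd K) (snd K p + t *\<^sub>R v))) has_derivative
      (\<lambda>t. t *\<^sub>R v)) (at 0)"
    by (rule has_derivative_cong_nhds) (use ev in eventually_elim, simp add: f_inv_into_f)
  moreover have "\<forall>\<^sub>F t in nhds (0::real). inv_into (fst K) (snd K) (snd K p + t *\<^sub>R v) \<in> fst K"
    using ev by eventually_elim (rule inv_into_into)
  ultimately show ?thesis
    by (simp add: has_chart_derivative_def inv_into_def[of UNIV, simplified] inv_id)
qed

lemma smooth_map_on_pts:
  assumes "smooth_map_on M N A f" "p \<in> A"
  shows "p \<in> pts M" "f p \<in> pts N"
proof -
  have A: "openin (topo M) A" "continuous_map (subtopology (topo M) A) (topo N) f"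
    using assms(1) by (auto simp: smooth_map_on_def)
  show p: "p \<in> pts M" using A(1) assms(2) openin_subset by blast
  show "f p \<in> pts N"
    using continuous_map_image_subset_topspace[OF A(2)] p assms(2) by auto
qed

lemma smooth_map_on_derivative:
  assumes "smooth_manifold M" "smooth_manifold N" "smooth_map_on M N A f" "p \<in> A"
  shows "\<exists>f'. has_chart_derivative (chart_at M p) (chart_at N (f p)) f p f'"
  using smooth_map_on_pts[OF assms(3,4)]
  by (intro smooth_map_on_has_chart_derivative[OF assms(3)] chart_at_atlas chart_at_is_chart assms)

lemma smooth_map_on_derivative_from_prod:
  assumes M: "smooth_manifold M1" "smooth_manifold M2" and N: "smooth_manifold N"
    and f: "smooth_map_on (prod_mfd M1 M2) N A f" "(a, b) \<in> A"
  shows "\<exists>f'. has_chart_derivative (prod_chart (chart_at M1 a) (chart_at M2 b)) (chart_at N (f (a, b))) f (a, b) f'"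
proof -
  have ab: "a \<in> pts M1" "b \<in> pts M2"
    using smooth_map_on_pts(1)[OF f] by (auto simp: prod_mfd_def)
  have fab: "f (a, b) \<in> pts N" using smooth_map_on_pts(2)[OF f] .
  show ?thesis
  proof (rule smooth_map_on_has_chart_derivative[OF f(1)])
    show "prod_chart (chart_at M1 a) (chart_at M2 b) \<in> atlas (prod_mfd M1 M2)"
      using M ab by (intro prod_chart_atlas chart_at_atlas)
    show "prod_chart (chart_at M1 a) (chart_at M2 b) \<in> chart_set (prod_mfd M1 M2)"
      using M ab by (intro chart_set_prod chart_at_is_chart)
    show "(a, b) \<in> fst (prod_chart (chart_at M1 a) (chart_at M2 b))"
      using M ab by (simp add: prod_chart_def chart_at_atlas)
  qed (use N f fab chart_at_atlas chart_at_is_chart in auto)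
qed

lemma smooth_map_on_derivative_to_prod:
  assumes M: "smooth_manifold M" and N: "smooth_manifold N1" "smooth_manifold N2"
    and f: "smooth_map_on M (prod_mfd N1 N2) A f" "p \<in> A" "f p = (c, d)"
  shows "\<exists>f'. has_chart_derivative (chart_at M p) (prod_chart (chart_at N1 c) (chart_at N2 d)) f p f'"
proof -
  have p: "p \<in> pts M" using smooth_map_on_pts(1)[OF f(1,2)] .
  have cd: "c \<in> pts N1" "d \<in> pts N2"
    using smooth_map_on_pts(2)[OF f(1,2)] f(3) by (auto simp: prod_mfd_def)
  show ?thesis
  proof (rule smooth_map_on_has_chart_derivative[OF f(1)])
    show "prod_chart (chart_at N1 c) (chart_at N2 d) \<in> atlas (prod_mfd N1 N2)"
      using N cd by (intro prod_chart_atlas chart_at_atlas)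
    show "prod_chart (chart_at N1 c) (chart_at N2 d) \<in> chart_set (prod_mfd N1 N2)"
      using N cd by (intro chart_set_prod chart_at_is_chart)
    show "f p \<in> fst (prod_chart (chart_at N1 c) (chart_at N2 d))"
      using N cd f(3) by (simp add: prod_chart_def chart_at_atlas)
  qed (use M f p chart_at_atlas chart_at_is_chart in auto)
qed

section \<open>Smooth curves\<close>

lemma Ck_on_cong_open:
  assumes "open S" "\<And>x. x \<in> S \<Longrightarrow> f x = g x" "Ck_on k S f"
  shows "Ck_on k S g"
  using assms(2,3)
proof (induction k arbitrary: f g)
  case 0
  then show ?case by (simp cong: continuous_on_cong)
next
  case (Suc k)
  have der: "(g has_derivative frechet_derivative f (at x)) (at x)" if "x \<in> S" for x
    using has_derivative_transform_within_open[OF _ assms(1) that, of f _ UNIV g] Suc.prems that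
    by (simp add: frechet_derivative_works)
  show ?case
    unfolding Ck_on.simps
  proof (intro conjI ballI allI)
    fix x assume "x \<in> S"
    then show "g differentiable at x" using der unfolding differentiable_def by blast
  next
    fix v
    show "Ck_on k S (\<lambda>x. frechet_derivative g (at x) v)"
    proof (rule Suc.IH)
      show "Ck_on k S (\<lambda>x. frechet_derivative f (at x) v)" using Suc.prems by simp
      show "frechet_derivative f (at x) v = frechet_derivative g (at x) v" if "x \<in> S" for x
        using frechet_derivative_at[OF der[OF that]] by simp
    qed
  qed
qed

text \<open>
  Differentiating along a line turns \<open>f\<close> into its derivative in a fixed direction. The
  induction hypothesis applies to that function again, so the chain rule for first derivatives
  carries the whole induction.
\<close>

lemma Ck_on_line:
  fixes T :: "real set"
  assumes "open T" "\<And>t. t \<in> T \<Longrightarrow> a + t *\<^sub>R w \<in> S" "Ck_on k S f"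
  shows "Ck_on k T (\<lambda>t. f (a + t *\<^sub>R w))"
  using assms(3)
proof (induction k arbitrary: f)
  case 0
  have "continuous_on T (\<lambda>t. a + t *\<^sub>R w)" by (intro continuous_intros)
  then show ?case
    using continuous_on_compose2[of S f T "\<lambda>t. a + t *\<^sub>R w"] 0 assms(2) by auto
next
  case (Suc k)
  have der: "((\<lambda>t. f (a + t *\<^sub>R w)) has_derivative (\<lambda>v. frechet_derivative f (at (a + t *\<^sub>R w)) (v *\<^sub>R w))) (at t)"
    if "t \<in> T" for t
  proof -
    have "(f has_derivative frechet_derivative f (at (a + t *\<^sub>R w))) (at (a + t *\<^sub>R w))"
      using Suc.prems assms(2)[OF that] by (simp add: frechet_derivative_works)
    moreover have "((\<lambda>t. a + t *\<^sub>R w) has_derivative (\<lambda>v. v *\<^sub>R w)) (at t)"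
      by (auto intro!: derivative_eq_intros)
    ultimately show ?thesis using diff_chain_at by (fastforce simp: o_def)
  qed
  show ?case
    unfolding Ck_on.simps
  proof (intro conjI ballI allI)
    fix t assume "t \<in> T"
    then show "(\<lambda>t. f (a + t *\<^sub>R w)) differentiable at t" using der unfolding differentiable_def by blast
  next
    fix v :: real
    have "Ck_on k T (\<lambda>t. frechet_derivative f (at (a + t *\<^sub>R w)) (v *\<^sub>R w))"
      using Suc.IH[of "\<lambda>x. frechet_derivative f (at x) (v *\<^sub>R w)"] Suc.prems by simp
    then show "Ck_on k T (\<lambda>t. frechet_derivative (\<lambda>t. f (a + t *\<^sub>R w)) (at t) v)"
    proof (rule Ck_on_cong_open[OF assms(1), rotated])
      fix t assume "t \<in> T"
      then show "frechet_derivative f (at (a + t *\<^sub>R w)) (v *\<^sub>R w) = frechet_derivative (\<lambda>t. f (a + t *\<^sub>R w)) (at t) v"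
        using frechet_derivative_at[OF der] by metis
    qed
  qed
qed

text \<open>
  Tangent spaces of submanifolds consist of velocities of smooth curves. Such curves are obtained
  as images of coordinate lines under a smooth map.
\<close>

lemma smooth_map_on_line:
  assumes N: "smooth_manifold N" and f: "smooth_map_on M N A f"
    and K: "K \<in> atlas M" "K \<in> chart_set M" and p: "p \<in> A" "p \<in> fst K"
  obtains \<epsilon> where "\<epsilon> > 0"
    "smooth_map_on real_mfd N {-\<epsilon><..<\<epsilon>} (\<lambda>t. f (inv_into (fst K) (snd K) (snd K p + t *\<^sub>R v)))"
    "\<forall>t\<in>{-\<epsilon><..<\<epsilon>}. snd K p + t *\<^sub>R v \<in> snd K ` (A \<inter> fst K)"
proof -
  obtain U \<phi> where K_eq: "K = (U, \<phi>)" by (cases K)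
  have A: "openin (topo M) A" and cont: "continuous_map (subtopology (topo M) A) (topo N) f"
    using f by (auto simp: smooth_map_on_def)
  have U: "openin (topo M) U" and opn: "\<And>W. openin (topo M) W \<Longrightarrow> W \<subseteq> U \<Longrightarrow> open (\<phi> ` W)"
    and inv: "\<And>x. x \<in> U \<Longrightarrow> inv_into U \<phi> (\<phi> x) = x"
    using K(2) by (auto simp: chart_set_def K_eq)
  let ?line = "\<lambda>t::real. \<phi> p + t *\<^sub>R v"
  let ?c = "\<lambda>t. f (inv_into U \<phi> (?line t))"
  have opl: "open (?line -` W)" if "open W" for W
    by (rule open_vimage[OF that]) (intro continuous_intros)
  have pre: "openin (topo M) {x \<in> A \<inter> U. f x \<in> V}" if "openin (topo N) V" for V
  proof -
    have "topspace (subtopology (topo M) A) = A" using A openin_subset by fastforce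
    then have "openin (subtopology (topo M) A) {x \<in> A. f x \<in> V}"
      using openin_continuous_map_preimage[OF cont that] by simp
    then have "openin (topo M) {x \<in> A. f x \<in> V}" using A openin_trans_full by blast
    then have "openin (topo M) ({x \<in> A. f x \<in> V} \<inter> U)" using U by (rule openin_Int)
    moreover have "{x \<in> A. f x \<in> V} \<inter> U = {x \<in> A \<inter> U. f x \<in> V}" by blast
    ultimately show ?thesis by simp
  qed
  have "open (?line -` \<phi> ` (A \<inter> U))"
    using A U by (intro opl opn) auto
  moreover have "0 \<in> ?line -` \<phi> ` (A \<inter> U)" using p by (simp add: K_eq)
  ultimately obtain \<epsilon> where \<epsilon>: "\<epsilon> > 0" "ball 0 \<epsilon> \<subseteq> ?line -` \<phi> ` (A \<inter> U)"
    using open_contains_ball by blast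
  let ?T = "{-\<epsilon><..<\<epsilon>}"
  have T: "?line t \<in> \<phi> ` (A \<inter> U)" if "t \<in> ?T" for t
  proof -
    have "t \<in> ball 0 \<epsilon>" using that by auto
    then show ?thesis using \<epsilon>(2) by blast
  qed
  have cV: "{t \<in> ?T. ?c t \<in> V} = ?T \<inter> ?line -` \<phi> ` {x \<in> A \<inter> U. f x \<in> V}" for V
  proof (intro Set.set_eqI iffI)
    fix t assume t: "t \<in> {t \<in> ?T. ?c t \<in> V}"
    then obtain x where x: "x \<in> A \<inter> U" "?line t = \<phi> x" using T by blast
    then have "f x \<in> V" using t inv by simp
    then show "t \<in> ?T \<inter> ?line -` \<phi> ` {x \<in> A \<inter> U. f x \<in> V}" using x t by blast
  next
    fix t assume t: "t \<in> ?T \<inter> ?line -` \<phi> ` {x \<in> A \<inter> U. f x \<in> V}"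
    then obtain x where x: "x \<in> A \<inter> U" "f x \<in> V" "?line t = \<phi> x" by blast
    then show "t \<in> {t \<in> ?T. ?c t \<in> V}" using inv t by simp
  qed
  have cVo: "open {t \<in> ?T. ?c t \<in> V}" if "openin (topo N) V" for V
    unfolding cV by (intro open_Int open_greaterThanLessThan opl opn pre that) auto
  have "smooth_map_on real_mfd N ?T ?c"
    unfolding smooth_map_on_def
  proof (intro conjI)
    show "openin (topo real_mfd) ?T" by (simp add: real_mfd_def)
    show "continuous_map (subtopology (topo real_mfd) ?T) (topo N) ?c"
      unfolding continuous_map_def
    proof (intro conjI allI impI)
      show "?c \<in> topspace (subtopology (topo real_mfd) ?T) \<rightarrow> pts N"
      proof
        fix t assume "t \<in> topspace (subtopology (topo real_mfd) ?T)"
        then obtain x where "x \<in> A \<inter> U" "?line t = \<phi> x" using T[of t] by (auto simp: real_mfd_def)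
        then show "?c t \<in> pts N" using inv smooth_map_on_pts(2)[OF f] by simp
      qed
      fix V assume "openin (topo N) V"
      then have "openin (top_of_set ?T) {t \<in> ?T. ?c t \<in> V}"
        by (intro open_subset cVo) auto
      then show "openin (subtopology (topo real_mfd) ?T) {t \<in> topspace (subtopology (topo real_mfd) ?T). ?c t \<in> V}"
        by (simp add: real_mfd_def)
    qed
    show "\<forall>(U, \<phi>)\<in>atlas real_mfd. \<forall>(V, \<psi>)\<in>atlas N.
        smooth_on (\<phi> ` {t \<in> ?T \<inter> U. ?c t \<in> V}) (\<psi> \<circ> ?c \<circ> inv_into U \<phi>)"
    proof clarify
      fix U' \<phi>' V \<psi> assume "(U', \<phi>') \<in> atlas real_mfd" and V: "(V, \<psi>) \<in> atlas N"
      then have id: "U' = UNIV" "\<phi>' = id" by (auto simp: real_mfd_def)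
      have Vo: "openin (topo N) V"
        using N V by (auto simp: smooth_manifold_def smooth_chart_def is_chart_def)
      have "smooth_on (\<phi> ` {p \<in> A \<inter> U. f p \<in> V}) (\<psi> \<circ> f \<circ> inv_into U \<phi>)"
        using f K(1) V by (auto simp: smooth_map_on_def K_eq)
      then have "Ck_on k {t \<in> ?T. ?c t \<in> V} (\<lambda>t. (\<psi> \<circ> f \<circ> inv_into U \<phi>) (?line t))" for k
        by (intro Ck_on_line[where S = "\<phi> ` {p \<in> A \<inter> U. f p \<in> V}", OF cVo[OF Vo]])
          (unfold cV smooth_on_def, blast+)
      then show "smooth_on (\<phi>' ` {t \<in> ?T \<inter> U'. ?c t \<in> V}) (\<psi> \<circ> ?c \<circ> inv_into U' \<phi>')"
        by (simp add: smooth_on_def id o_def inv_id)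
    qed
  qed
  with \<epsilon>(1) T show thesis by (intro that[of \<epsilon>]) (auto simp: K_eq)
qed

section \<open>Variations of a discrete action\<close>

text \<open>
  The action is a sum of functions of two neighbouring points; the chain rule applies to each
  summand along a pair of coordinate lines.
\<close>

lemma curve_differential_eq:
  fixes M :: "('a, 'e::real_normed_vector) mfd"
  assumes M: "smooth_manifold M" and q: "\<forall>k\<le>N. q k \<in> pts M"
    and L: "\<forall>k<N. \<exists>L'. has_chart_derivative (prod_chart (chart_at M (q k)) (chart_at M (q (Suc k))))
      (UNIV, id) L (q k, q (Suc k)) L'"
  shows "curve_differential M (disc_action L N) q \<delta> =
    (\<Sum>k<N. partial1 M real_mfd L (q k, q (Suc k)) (\<delta> k) +
       partial2 M real_mfd L (q k, q (Suc k)) (\<delta> (Suc k)))"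
proof -
  define c where "c = (\<lambda>k t. chart_inv M (q k) (chart_map M (q k) (q k) + t *\<^sub>R \<delta> k))"
  have "((\<lambda>t. L (c k t, c (Suc k) t)) has_field_derivative
      (partial1 M real_mfd L (q k, q (Suc k)) (\<delta> k) +
       partial2 M real_mfd L (q k, q (Suc k)) (\<delta> (Suc k)))) (at 0)" if "k < N" for k
  proof -
    have k: "q k \<in> pts M" "q (Suc k) \<in> pts M" using q that by auto
    note K1 = chart_at_is_chart[OF M k(1)] chart_at_atlas[OF M k(1)]
    note K2 = chart_at_is_chart[OF M k(2)] chart_at_atlas[OF M k(2)]
    note inj = chart_setD(2)[OF chart_set_prod[OF K1(2) K2(2)]]
    obtain L' where L': "has_chart_derivative (prod_chart (chart_at M (q k)) (chart_at M (q (Suc k))))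
      (UNIV, id) L (q k, q (Suc k)) L'" using L \<open>k < N\<close> by blast
    have c: "has_chart_derivative (UNIV, id) (chart_at M (q j)) (c j) 0 (\<lambda>t. t *\<^sub>R \<delta> j)" "c j 0 = q j"
      if "j \<in> {k, Suc k}" for j
    proof -
      have j: "q j \<in> pts M" using k that by auto
      note K = chart_at_is_chart[OF M j] chart_at_atlas[OF M j]
      show "has_chart_derivative (UNIV, id) (chart_at M (q j)) (c j) 0 (\<lambda>t. t *\<^sub>R \<delta> j)"
        using has_chart_derivative_line[OF K(2,5)] by (simp add: c_def chart_inv_def chart_map_def)
      show "c j 0 = q j"
        using K by (simp add: c_def chart_inv_def chart_map_def)
    qed
    have "has_chart_derivative (UNIV, id) (UNIV, id) (\<lambda>t. L (c k t, c (Suc k) t)) 0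
        (\<lambda>t. L' (t *\<^sub>R \<delta> k, t *\<^sub>R \<delta> (Suc k)))"
      by (rule has_chart_derivative_compose[OF _ inj has_chart_derivative_Pair[OF c(1) c(1)]])
        (use c(2) L' in auto)
    then have "((\<lambda>t. L (c k t, c (Suc k) t)) has_derivative (\<lambda>t. L' (t *\<^sub>R \<delta> k, t *\<^sub>R \<delta> (Suc k)))) (at 0)"
      by (simp add: has_chart_derivative_def inv_into_def[of UNIV, simplified] inv_id)
    moreover have lin: "linear L'" using has_chart_derivative_linear[OF L'] .
    have "(\<lambda>t. L' (t *\<^sub>R \<delta> k, t *\<^sub>R \<delta> (Suc k))) = (*) (L' (\<delta> k, \<delta> (Suc k)))"
      using linear_scale[OF lin, of _ "(\<delta> k, \<delta> (Suc k))"] by (simp add: fun_eq_iff mult.commute)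
    moreover have "L' (\<delta> k, \<delta> (Suc k)) = L' (\<delta> k, 0) + L' (0, \<delta> (Suc k))"
      using linear_add[OF lin, of "(\<delta> k, 0)" "(0, \<delta> (Suc k))"] by simp
    moreover have "partial1 M real_mfd L (q k, q (Suc k)) = (\<lambda>v. L' (v, 0))"
      "partial2 M real_mfd L (q k, q (Suc k)) = (\<lambda>v. L' (0, v))"
      using partial_eq[OF M M k, where N = real_mfd] L' by (simp_all add: real_chart)
    ultimately show ?thesis by (simp add: has_field_derivative_def)
  qed
  then have "((\<lambda>t. \<Sum>k<N. L (c k t, c (Suc k) t)) has_field_derivative
      (\<Sum>k<N. partial1 M real_mfd L (q k, q (Suc k)) (\<delta> k) +
       partial2 M real_mfd L (q k, q (Suc k)) (\<delta> (Suc k)))) (at 0)"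
    by (intro DERIV_sum) auto
  then show ?thesis
    unfolding curve_differential_def disc_action_def using DERIV_imp_deriv by (simp add: c_def)
qed

text \<open>
  Summation by parts: each interior index collects the two summands in which it occurs, and the
  terms at the two ends drop out.
\<close>

lemma sum_shift_vanishing_ends:
  fixes a b :: "nat \<Rightarrow> real"
  assumes "a 0 = 0" "b N = 0"
  shows "(\<Sum>k<N. a k + b (Suc k)) = (\<Sum>k = 1..<N. a k + b k)"
proof -
  have "(\<Sum>k<n. a k + b (Suc k)) = (\<Sum>k = 1..<n. a k + b k) + b n" if "n > 0" for n
    using that assms(1) by (induction n rule: nat_induct_non_zero) auto
  then show ?thesis using assms(2) by (cases "N = 0") auto
qed

lemma curve_differential_vanishing_ends:
  fixes M :: "('a, 'e::real_normed_vector) mfd"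
  assumes M: "smooth_manifold M" and q: "\<forall>k\<le>N. q k \<in> pts M"
    and L: "\<forall>k<N. \<exists>L'. has_chart_derivative (prod_chart (chart_at M (q k)) (chart_at M (q (Suc k))))
      (UNIV, id) L (q k, q (Suc k)) L'"
    and \<delta>: "\<delta> 0 = 0" "\<delta> N = 0"
  shows "curve_differential M (disc_action L N) q \<delta> =
    (\<Sum>k = 1..<N. partial1 M real_mfd L (q k, q (k + 1)) (\<delta> k) +
       partial2 M real_mfd L (q (k - 1), q k) (\<delta> k))"
proof (cases "N = 0")
  case True
  then show ?thesis using curve_differential_eq[OF M q L] by simp
next
  case False
  have zero: "partial1 M real_mfd L (q k, q (Suc k)) 0 = 0" "partial2 M real_mfd L (q k, q (Suc k)) 0 = 0"
    if "k < N" for k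
  proof -
    have k: "q k \<in> pts M" "q (Suc k) \<in> pts M" using q that by auto
    note K = chart_at_is_chart(2)[OF M k(1)] chart_at_is_chart(2)[OF M k(2)]
    obtain L' where L': "has_chart_derivative (prod_chart (chart_at M (q k)) (chart_at M (q (Suc k))))
      (UNIV, id) L (q k, q (Suc k)) L'" using L \<open>k < N\<close> by blast
    have "L' (0, 0) = 0"
      using linear_0[OF has_chart_derivative_linear[OF L']]
      by (simp add: zero_prod_def)
    then show "partial1 M real_mfd L (q k, q (Suc k)) 0 = 0" "partial2 M real_mfd L (q k, q (Suc k)) 0 = 0"
      using partial_eq[OF M M k, where N = real_mfd] L' by (simp_all add: real_chart)
  qed
  show ?thesis
    unfolding curve_differential_eq[OF M q L]
    using sum_shift_vanishing_ends[of "\<lambda>k. partial1 M real_mfd L (q k, q (k + 1)) (\<delta> k)"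
        "\<lambda>k. partial2 M real_mfd L (q (k - 1), q k) (\<delta> k)" N] zero(1)[of 0] zero(2)[of "N - 1"] \<delta> False
    by simp
qed

text \<open>
  The fundamental lemma of the discrete calculus of variations: a variation supported at the single
  index \<open>k\<close> isolates the \<open>k\<close>-th summand.
\<close>

lemma variations_vanish_iff:
  fixes E :: "nat \<Rightarrow> 'e::real_vector \<Rightarrow> real"
  assumes W: "\<forall>k\<le>N. 0 \<in> W k" and E: "\<forall>k. 1 \<le> k \<and> k < N \<longrightarrow> E k 0 = 0"
  shows "(\<forall>\<delta>. \<delta> 0 = 0 \<and> \<delta> N = 0 \<and> (\<forall>k\<le>N. \<delta> k \<in> W k) \<longrightarrow> (\<Sum>k = 1..<N. E k (\<delta> k)) = 0) \<longleftrightarrow>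
    (\<forall>k. 1 \<le> k \<and> k < N \<longrightarrow> (\<forall>v\<in>W k. E k v = 0))" (is "?l \<longleftrightarrow> ?r")
proof
  assume ?l
  show ?r
  proof (intro allI impI ballI)
    fix k v assume k: "1 \<le> k \<and> k < N" and v: "v \<in> W k"
    have "(\<Sum>j = 1..<N. E j (if j = k then v else 0)) = 0"
      using \<open>?l\<close>[rule_format, of "\<lambda>j. if j = k then v else 0"] k v W by auto
    moreover have "(\<Sum>j = 1..<N. E j (if j = k then v else 0)) = (\<Sum>j = 1..<N. if j = k then E k v else 0)"
      using E by (intro sum.cong) auto
    ultimately show "E k v = 0" using k by simp
  qed
qed (auto intro!: sum.neutral)

section \<open>The discrete connection and the reduced Lagrangian\<close>

text \<open>
  The constructions below, and the key identity \<open>reduced_partials\<close>, concern pairs of points; only the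
  hypotheses on a discrete curve are therefore absent from the context.
\<close>

locale chaplygin_reduction =
  fixes Q :: "('q, 'e::real_normed_vector) mfd"
    and MG :: "('g, 'f::real_normed_vector) mfd"
    and G :: "('g, 'z) monoid_scheme"
    and l :: "'g \<Rightarrow> 'q \<Rightarrow> 'q"
    and B :: "('q set, 'h::real_normed_vector) mfd"
    and L :: "'q \<times> 'q \<Rightarrow> real"
    and D :: "'q \<Rightarrow> 'e set"
    and Dd :: "('q \<times> 'q) set"
    and \<gamma> :: "'q \<Rightarrow> 'g"
    and U :: "('q \<times> 'q) set"
    and \<O> :: "('q set \<times> 'q set) set"
    and Ad :: "'q \<times> 'q \<Rightarrow> 'g"
    and hb :: "'q \<Rightarrow> 'q set \<Rightarrow> 'q"
    and h :: "'q \<Rightarrow> 'h \<Rightarrow> 'e"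
    and Lb :: "'q set \<times> 'q set \<Rightarrow> real"
    and Fp Fm :: "'q set \<times> 'q set \<Rightarrow> 'h \<Rightarrow> real"
  assumes system: "nonholonomic_discrete_system Q L D Dd"
    and chaplygin: "chaplygin_symmetry_group MG G l B Q L D Dd \<gamma>"
    and nbhds: "conn_neighbourhoods Q MG G l B \<gamma> Dd U \<O>"
    and Ad: "Ad = disc_conn G l Dd U"
    and hb: "hb = disc_hor_lift Q G l Ad"
    and h: "h = hor_lift Q G l B D"
    and Lb: "Lb = breve_L G l L hb"
    and Fp: "Fp = breve_F_plus Q MG G l L Ad hb h"
    and Fm: "Fm = breve_F_minus Q MG G l L Ad hb h"
begin

abbreviation proj :: "'q \<Rightarrow> 'q set" ("\<pi>") where "\<pi> \<equiv> orbit G l"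

abbreviation dom_Ad :: "('q \<times> 'q) set" where "dom_Ad \<equiv> conn_domain Q G l \<O>"

lemma symmetry:
  "lie_group MG G" "smooth_free_proper_action Q MG G l" "principal_bundle Q MG G l B"
  "smooth_manifold Q" "smooth_manifold MG" "smooth_manifold B" "pts MG = carrier G"
  "pts B = orbits G (pts Q) l"
  using system chaplygin
  by (auto simp: nonholonomic_discrete_system_def chaplygin_symmetry_group_def symmetry_group_def
      lie_group_def principal_bundle_def)

lemma L_invariant: "g \<in> carrier G \<Longrightarrow> x \<in> pts Q \<Longrightarrow> y \<in> pts Q \<Longrightarrow> L (l g x, l g y) = L (x, y)"
  using chaplygin by (simp add: chaplygin_symmetry_group_def symmetry_group_def)

lemma D_invariant: "g \<in> carrier G \<Longrightarrow> x \<in> pts Q \<Longrightarrow> mfderiv Q Q (l g) x ` D x = D (l g x)"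
  using chaplygin by (simp add: chaplygin_symmetry_group_def symmetry_group_def)

lemma vertical_complement: "x \<in> pts Q \<Longrightarrow> direct_sum (vertical_space Q G l x) (D x)"
  using chaplygin by (simp add: chaplygin_symmetry_group_def)

sublocale grp: group G
  using symmetry(1) by (simp add: lie_group_def)

sublocale act: group_action G "pts Q" l
  using symmetry(2) by (simp add: smooth_free_proper_action_def)

lemma l_pts [simp]: "g \<in> carrier G \<Longrightarrow> x \<in> pts Q \<Longrightarrow> l g x \<in> pts Q"
  using act.element_image by blast

lemma l_one [simp]: "x \<in> pts Q \<Longrightarrow> l \<one>\<^bsub>G\<^esub> x = x"
  using act.id_eq_one by (metis restrict_apply')

lemma l_mult: "g \<in> carrier G \<Longrightarrow> k \<in> carrier G \<Longrightarrow> x \<in> pts Q \<Longrightarrow> l (g \<otimes>\<^bsub>G\<^esub> k) x = l g (l k x)"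
  using act.composition_rule by blast

lemma l_inv_l [simp]: "g \<in> carrier G \<Longrightarrow> x \<in> pts Q \<Longrightarrow> l (inv\<^bsub>G\<^esub> g) (l g x) = x"
  by (simp add: l_mult[symmetric])

lemma in_proj: "x \<in> pts Q \<Longrightarrow> x \<in> \<pi> x"
  by (rule act.orbit_refl)

lemma proj_l [simp]:
  assumes "g \<in> carrier G" "x \<in> pts Q"
  shows "\<pi> (l g x) = \<pi> x"
proof -
  have "l k (l g x) \<in> \<pi> x" if "k \<in> carrier G" for k
    using that assms unfolding orbit_def by (auto simp: l_mult[symmetric])
  moreover have "l k x \<in> \<pi> (l g x)" if "k \<in> carrier G" for k
  proof -
    have "l k x = l (k \<otimes>\<^bsub>G\<^esub> inv\<^bsub>G\<^esub> g) (l g x)" using that assms by (simp add: l_mult)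
    then show ?thesis using that assms unfolding orbit_def by blast
  qed
  ultimately show ?thesis by (fastforce simp: orbit_def)
qed

lemma proj_eqD:
  assumes "y \<in> pts Q" "\<pi> y = \<pi> x"
  obtains g where "g \<in> carrier G" "y = l g x"
  using in_proj[OF assms(1)] assms(2) unfolding orbit_def by auto

lemma proj_pts [simp]: "x \<in> pts Q \<Longrightarrow> \<pi> x \<in> pts B"
  by (auto simp: symmetry orbits_def)

lemma dom_Ad_iff: "(x, y) \<in> dom_Ad \<longleftrightarrow> x \<in> pts Q \<and> y \<in> pts Q \<and> (\<pi> x, \<pi> y) \<in> \<O>"
  by (auto simp: conn_domain_def)

lemma dom_Ad_l: "(x, y) \<in> dom_Ad \<Longrightarrow> g \<in> carrier G \<Longrightarrow> k \<in> carrier G \<Longrightarrow> (l g x, l k y) \<in> dom_Ad"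
  by (simp add: dom_Ad_iff)

lemma Ad_smooth: "smooth_map_on (prod_mfd Q Q) MG dom_Ad Ad"
  using nbhds by (simp add: conn_neighbourhoods_def Ad)

lemma Dd_U_invariant: "(x, y) \<in> Dd \<inter> U \<Longrightarrow> g \<in> carrier G \<Longrightarrow> (l g x, l g y) \<in> Dd \<inter> U"
  using nbhds chaplygin
  by (fastforce simp: conn_neighbourhoods_def chaplygin_symmetry_group_def symmetry_group_def diag_invariant_def)

lemma Ad_unique:
  assumes "(x, y) \<in> dom_Ad"
  shows "\<exists>!g. g \<in> carrier G \<and> (x, l (inv\<^bsub>G\<^esub> g) y) \<in> Dd \<inter> U"
  using nbhds assms unfolding conn_neighbourhoods_def by blast

lemma Ad_closed [simp]: "(x, y) \<in> dom_Ad \<Longrightarrow> Ad (x, y) \<in> carrier G"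
  and Ad_horizontal: "(x, y) \<in> dom_Ad \<Longrightarrow> (x, l (inv\<^bsub>G\<^esub> (Ad (x, y))) y) \<in> Dd \<inter> U"
  using theI'[OF Ad_unique, of x y] by (simp_all add: Ad disc_conn_def)

lemma Ad_eqI:
  assumes "(x, y) \<in> dom_Ad" "g \<in> carrier G" "(x, l (inv\<^bsub>G\<^esub> g) y) \<in> Dd \<inter> U"
  shows "Ad (x, y) = g"
  using the1_equality[OF Ad_unique[OF assms(1)]] assms(2,3) by (simp add: Ad disc_conn_def)

text \<open>
  The element \<open>Ad (x, y)\<close> moves the horizontal partner of \<open>x\<close> in the orbit of \<open>y\<close> to \<open>y\<close>; moving
  \<open>y\<close> further by \<open>g\<close> multiplies it by \<open>g\<close>.
\<close>

lemma Ad_l_right: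
  assumes xy: "(x, y) \<in> dom_Ad" and g: "g \<in> carrier G"
  shows "Ad (x, l g y) = g \<otimes>\<^bsub>G\<^esub> Ad (x, y)"
proof (rule Ad_eqI)
  have y: "x \<in> pts Q" "y \<in> pts Q" using xy by (auto simp: dom_Ad_iff)
  show "(x, l g y) \<in> dom_Ad" using xy g by (simp add: dom_Ad_iff)
  show "g \<otimes>\<^bsub>G\<^esub> Ad (x, y) \<in> carrier G" using xy g by simp
  have "l (inv\<^bsub>G\<^esub> (g \<otimes>\<^bsub>G\<^esub> Ad (x, y))) (l g y) = l (inv\<^bsub>G\<^esub> (Ad (x, y))) y"
    using xy g y by (simp add: grp.inv_mult_group l_mult)
  then show "(x, l (inv\<^bsub>G\<^esub> (g \<otimes>\<^bsub>G\<^esub> Ad (x, y))) (l g y)) \<in> Dd \<inter> U"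
    using Ad_horizontal[OF xy] by simp
qed

lemma Ad_l_diag:
  assumes xy: "(x, y) \<in> dom_Ad" and g: "g \<in> carrier G"
  shows "Ad (l g x, l g y) = g \<otimes>\<^bsub>G\<^esub> Ad (x, y) \<otimes>\<^bsub>G\<^esub> inv\<^bsub>G\<^esub> g"
proof (rule Ad_eqI)
  have y: "x \<in> pts Q" "y \<in> pts Q" using xy by (auto simp: dom_Ad_iff)
  show "(l g x, l g y) \<in> dom_Ad" using xy g by (simp add: dom_Ad_iff)
  show "g \<otimes>\<^bsub>G\<^esub> Ad (x, y) \<otimes>\<^bsub>G\<^esub> inv\<^bsub>G\<^esub> g \<in> carrier G" using xy g by simp
  have "l (inv\<^bsub>G\<^esub> (g \<otimes>\<^bsub>G\<^esub> Ad (x, y) \<otimes>\<^bsub>G\<^esub> inv\<^bsub>G\<^esub> g)) (l g y) = l g (l (inv\<^bsub>G\<^esub> (Ad (x, y))) y)"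
    using xy g y by (simp add: grp.inv_mult_group l_mult grp.m_assoc)
  then show "(l g x, l (inv\<^bsub>G\<^esub> (g \<otimes>\<^bsub>G\<^esub> Ad (x, y) \<otimes>\<^bsub>G\<^esub> inv\<^bsub>G\<^esub> g)) (l g y)) \<in> Dd \<inter> U"
    using Dd_U_invariant[OF Ad_horizontal[OF xy] g] by simp
qed

text \<open>
  Moving any point \<open>y\<close> of the target orbit back by \<open>Ad (x, y)\<close> makes the pair horizontal. This
  expresses the discrete horizontal lift by the action and by \<open>Ad\<close>, both of which are smooth.
\<close>

lemma hb_proj:
  assumes xy: "(x, y) \<in> dom_Ad"
  shows "hb x (\<pi> y) = l (inv\<^bsub>G\<^esub> (Ad (x, y))) y"
  unfolding hb disc_hor_lift_def
proof (rule the_equality)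
  have y: "y \<in> pts Q" using xy by (simp add: dom_Ad_iff)
  show "l (inv\<^bsub>G\<^esub> (Ad (x, y))) y \<in> pts Q \<and> \<pi> (l (inv\<^bsub>G\<^esub> (Ad (x, y))) y) = \<pi> y \<and>
      Ad (x, l (inv\<^bsub>G\<^esub> (Ad (x, y))) y) = \<one>\<^bsub>G\<^esub>"
    using xy y by (simp add: Ad_l_right)
  fix z assume z: "z \<in> pts Q \<and> \<pi> z = \<pi> y \<and> Ad (x, z) = \<one>\<^bsub>G\<^esub>"
  then obtain g where g: "g \<in> carrier G" "z = l g y" using proj_eqD by blast
  then have "g \<otimes>\<^bsub>G\<^esub> Ad (x, y) = \<one>\<^bsub>G\<^esub>" using z xy by (simp add: Ad_l_right)
  then have "g = inv\<^bsub>G\<^esub> (Ad (x, y))" using g xy by (simp add: grp.inv_equality)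
  then show "z = l (inv\<^bsub>G\<^esub> (Ad (x, y))) y" using g by simp
qed

text \<open>
  In a class \<open>\<rho> (x, e)\<close> every representative has group component \<open>e\<close>, since conjugation fixes \<open>e\<close>;
  the two choices made in the reduced objects together replace \<open>x\<close> by some point of its orbit.
\<close>

lemma chosen_representative:
  assumes "x \<in> pts Q"
  obtains g where "g \<in> carrier G"
    "(SOME z. z \<in> rho G l (SOME x'. x' \<in> \<pi> x, \<one>\<^bsub>G\<^esub>)) = (l g x, \<one>\<^bsub>G\<^esub>)"
proof -
  have "(SOME x'. x' \<in> \<pi> x) \<in> \<pi> x" using in_proj[OF assms] by (rule someI)
  then obtain g1 where g1: "g1 \<in> carrier G" "(SOME x'. x' \<in> \<pi> x) = l g1 x"
    unfolding orbit_def by auto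
  let ?R = "rho G l (l g1 x, \<one>\<^bsub>G\<^esub>)"
  have R: "?R = {(l g (l g1 x), \<one>\<^bsub>G\<^esub>) | g. g \<in> carrier G}"
    unfolding rho_def orbit_def by (auto; metis grp.r_inv grp.r_one)
  then have "?R \<noteq> {}" using grp.one_closed by blast
  then have "(SOME z. z \<in> ?R) \<in> ?R" by (simp add: some_in_eq)
  then obtain g2 where "g2 \<in> carrier G" "(SOME z. z \<in> ?R) = (l g2 (l g1 x), \<one>\<^bsub>G\<^esub>)"
    unfolding R by blast
  then show thesis
    using that[of "g2 \<otimes>\<^bsub>G\<^esub> g1"] g1 assms by (simp add: l_mult)
qed

text \<open>
  The formula on which the proof rests: pulled back to \<open>Q \<times> Q\<close>, the reduced Lagrangian is \<open>L\<close> after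
  the second point has been moved back to a horizontal position. The choice of a representative
  disappears because \<open>L\<close> is invariant and the discrete lift equivariant.
\<close>

lemma Lb_proj:
  assumes xy: "(x, y) \<in> dom_Ad"
  shows "Lb (\<pi> x, \<pi> y) = L (x, l (inv\<^bsub>G\<^esub> (Ad (x, y))) y)"
proof -
  have y: "x \<in> pts Q" "y \<in> pts Q" using xy by (auto simp: dom_Ad_iff)
  obtain g where g: "g \<in> carrier G"
    "(SOME z. z \<in> rho G l (SOME x'. x' \<in> \<pi> x, \<one>\<^bsub>G\<^esub>)) = (l g x, \<one>\<^bsub>G\<^esub>)"
    using chosen_representative y by blast
  have "(l g x, l g y) \<in> dom_Ad" using xy g by (simp add: dom_Ad_iff)
  then have "hb (l g x) (\<pi> (l g y)) = l (inv\<^bsub>G\<^esub> (Ad (l g x, l g y))) (l g y)" by (rule hb_proj)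
  also have "\<dots> = l g (l (inv\<^bsub>G\<^esub> (Ad (x, y))) y)"
    using xy g y by (simp add: Ad_l_diag grp.inv_mult_group l_mult grp.m_assoc)
  finally have "hb (l g x) (\<pi> y) = l g (l (inv\<^bsub>G\<^esub> (Ad (x, y))) y)" using g y by simp
  then have "Lb (\<pi> x, \<pi> y) = L (l g x, l g (l (inv\<^bsub>G\<^esub> (Ad (x, y))) y))"
    using g xy y by (simp add: Lb breve_L_def upsilon_def hat_L_def check_L_def F1_tilde_def)
  then show ?thesis using L_invariant g y xy by simp
qed

definition horizontal_pair :: "'q \<Rightarrow> 'q \<Rightarrow> bool" where
  "horizontal_pair a b \<longleftrightarrow> (a, b) \<in> dom_Ad \<and> Ad (a, b) = \<one>\<^bsub>G\<^esub>"

lemma horizontal_pairI: "(a, b) \<in> Dd \<inter> U \<Longrightarrow> (a, b) \<in> dom_Ad \<Longrightarrow> horizontal_pair a b"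
  unfolding horizontal_pair_def using Ad_eqI[of a b "\<one>\<^bsub>G\<^esub>"] by (auto simp: dom_Ad_iff)

lemma horizontal_pair_pts:
  "horizontal_pair a b \<Longrightarrow> a \<in> pts Q" "horizontal_pair a b \<Longrightarrow> b \<in> pts Q"
  by (auto simp: horizontal_pair_def dom_Ad_iff)

lemma horizontal_pair_l: "horizontal_pair a b \<Longrightarrow> g \<in> carrier G \<Longrightarrow> horizontal_pair (l g a) (l g b)"
  by (auto simp: horizontal_pair_def Ad_l_diag dom_Ad_l)

lemma hb_horizontal_pair: "horizontal_pair a b \<Longrightarrow> hb a (\<pi> b) = b"
  by (auto simp: horizontal_pair_def hb_proj dom_Ad_iff)

text \<open>
  The chosen representative stays visible here. It is removed in \<open>reduced_partials\<close>, once the forces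
  have been expressed by derivatives of \<open>L\<close> and \<open>Lb\<close>, since \<open>L\<close> is invariant and the horizontal
  lift equivariant.
\<close>

lemma Fp_Fm_proj:
  assumes ab: "horizontal_pair a b"
  obtains g where "g \<in> carrier G"
    "\<And>v. Fm (\<pi> a, \<pi> b) v = mfderiv MG real_mfd (\<lambda>w. L (l g a, l w (l g b))) \<one>\<^bsub>G\<^esub>
      (partial1 Q MG Ad (l g a, l g b) (h (l g a) v))"
    "\<And>v. Fp (\<pi> a, \<pi> b) v = mfderiv MG real_mfd (\<lambda>w. L (l g a, l w (l g b))) \<one>\<^bsub>G\<^esub>
      (partial2 Q MG Ad (l g a, l g b) (h (l g b) v))"
proof -
  note pts = horizontal_pair_pts[OF ab]
  obtain g where g: "g \<in> carrier G"
    "(SOME z. z \<in> rho G l (SOME x'. x' \<in> \<pi> a, \<one>\<^bsub>G\<^esub>)) = (l g a, \<one>\<^bsub>G\<^esub>)"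
    using chosen_representative pts by blast
  have hb_g: "hb (l g a) (\<pi> b) = l g b"
    using hb_horizontal_pair[OF horizontal_pair_l[OF ab g(1)]] g pts by simp
  show thesis
    by (rule that[OF g(1)])
      (use g pts hb_g in \<open>simp_all add: Fm Fp breve_F_minus_def breve_F_plus_def upsilon_def
        hat_F_minus_def hat_F_plus_def check_L_def F1_tilde_def Let_def\<close>)
qed

section \<open>Tangent maps of the bundle\<close>

lemmas chart_Q = chart_at_is_chart[OF symmetry(4)] chart_at_atlas[OF symmetry(4)]
lemmas chart_MG = chart_at_is_chart[OF symmetry(5)] chart_at_atlas[OF symmetry(5)]
lemmas chart_B = chart_at_is_chart[OF symmetry(6)] chart_at_atlas[OF symmetry(6)]

lemma one_pts: "\<one>\<^bsub>G\<^esub> \<in> pts MG"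
  by (simp add: symmetry(7))

lemma L_derivative:
  assumes "x \<in> pts Q" "y \<in> pts Q"
  shows "\<exists>L'. has_chart_derivative (prod_chart (chart_at Q x) (chart_at Q y)) (UNIV, id) L (x, y) L'"
proof -
  have "smooth_map_on (prod_mfd Q Q) real_mfd (pts Q \<times> pts Q) L"
    using system by (simp add: nonholonomic_discrete_system_def)
  from smooth_map_on_derivative_from_prod[OF symmetry(4,4) smooth_manifold_real_mfd this, of x y] assms
  show ?thesis by (simp add: real_chart)
qed

lemma action_derivative:
  assumes "g \<in> carrier G" "x \<in> pts Q"
  shows "\<exists>l'. has_chart_derivative (prod_chart (chart_at MG g) (chart_at Q x)) (chart_at Q (l g x))
    (\<lambda>z. l (fst z) (snd z)) (g, x) l'"
proof -
  have "smooth_map_on (prod_mfd MG Q) Q (carrier G \<times> pts Q) (\<lambda>z. l (fst z) (snd z))"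
    using symmetry(2) by (simp add: smooth_free_proper_action_def case_prod_beta')
  from smooth_map_on_derivative_from_prod[OF symmetry(5,4,4) this, of g x] assms
  show ?thesis by simp
qed

lemma l_derivative:
  assumes g: "g \<in> carrier G" and x: "x \<in> pts Q"
  shows "has_chart_derivative (chart_at Q x) (chart_at Q (l g x)) (l g) x (mfderiv Q Q (l g) x)"
proof -
  have gM: "g \<in> pts MG" using g by (simp add: symmetry(7))
  obtain l' where l': "has_chart_derivative (prod_chart (chart_at MG g) (chart_at Q x)) (chart_at Q (l g x))
    (\<lambda>z. l (fst z) (snd z)) (g, x) l'"
    using action_derivative[OF assms] by blast
  have "has_chart_derivative (chart_at Q x) (chart_at Q (l g x)) (\<lambda>y. l (fst (g, y)) (snd (g, y))) x (\<lambda>v. l' (0, v))"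
    by (rule has_chart_derivative_compose[OF chart_Q(3)[OF x]
        chart_setD(2)[OF chart_set_prod[OF chart_MG(2)[OF gM] chart_Q(2)[OF x]]]
        has_chart_derivative_Pair[OF has_chart_derivative_const[OF chart_Q(5)[OF x] chart_MG(5)[OF gM]]
          has_chart_derivative_id[OF chart_Q(2)[OF x] chart_Q(5)[OF x]]] l'])
  then have *: "has_chart_derivative (chart_at Q x) (chart_at Q (l g x)) (l g) x (\<lambda>v. l' (0, v))" by simp
  from mfderiv_eq[OF *] * show ?thesis by simp
qed

lemma proj_derivative:
  assumes "x \<in> pts Q"
  shows "has_chart_derivative (chart_at Q x) (chart_at B (\<pi> x)) \<pi> x (mfderiv Q B \<pi> x)"
proof -
  have "smooth_map_on Q B (pts Q) \<pi>" using symmetry(3) by (simp add: principal_bundle_def)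
  from smooth_map_on_derivative[OF symmetry(4,6) this assms]
  obtain p' where "has_chart_derivative (chart_at Q x) (chart_at B (\<pi> x)) \<pi> x p'" by blast
  then show ?thesis using mfderiv_eq by metis
qed

lemma linear_mfderiv_proj: "x \<in> pts Q \<Longrightarrow> linear (mfderiv Q B \<pi> x)"
  using has_chart_derivative_linear[OF proj_derivative] by blast

text \<open>
  Differentiates \<open>\<pi> \<circ> l g = \<pi>\<close>.
\<close>

lemma proj_l_derivative:
  assumes g: "g \<in> carrier G" and x: "x \<in> pts Q"
  shows "mfderiv Q B \<pi> (l g x) (mfderiv Q Q (l g) x v) = mfderiv Q B \<pi> x v"
proof -
  have "has_chart_derivative (chart_at Q x) (chart_at B (\<pi> x)) (\<lambda>y. \<pi> (l g y)) x
      (\<lambda>v. mfderiv Q B \<pi> (l g x) (mfderiv Q Q (l g) x v))"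
    using has_chart_derivative_compose[OF chart_Q(3)[OF x] chart_Q(3) l_derivative[OF g x] proj_derivative] g x
    by simp
  then have "has_chart_derivative (chart_at Q x) (chart_at B (\<pi> x)) \<pi> x
      (\<lambda>v. mfderiv Q B \<pi> (l g x) (mfderiv Q Q (l g) x v))"
    by (rule has_chart_derivative_cong[OF chart_Q(2)[OF x] openin_topspace x, rotated]) (use g in simp)
  from has_chart_derivative_unique[OF this proj_derivative[OF x]] show ?thesis by (rule fun_cong)
qed

lemma local_trivialization:
  assumes x: "x \<in> pts Q"
  obtains V k \<Phi> \<Psi> where "openin (topo B) V" "\<pi> x \<in> V" "k \<in> carrier G" "\<Phi> (\<pi> x, k) = x" "\<Psi> x = (\<pi> x, k)"
    "smooth_map_on (prod_mfd B MG) Q (V \<times> carrier G) \<Phi>"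
    "smooth_map_on Q (prod_mfd B MG) {y \<in> pts Q. \<pi> y \<in> V} \<Psi>"
    "\<forall>y\<in>pts Q. \<pi> y \<in> V \<longrightarrow> \<Phi> (\<Psi> y) = y \<and> fst (\<Psi> y) = \<pi> y"
    "\<forall>s\<in>V. \<forall>g\<in>carrier G. \<Phi> (s, g) \<in> pts Q \<and> \<pi> (\<Phi> (s, g)) = s"
proof -
  have "\<pi> x \<in> pts B" using x by simp
  then obtain V \<Phi> where V: "openin (topo B) V" "\<pi> x \<in> V"
    and bij: "bij_betw \<Phi> (V \<times> carrier G) {y \<in> pts Q. \<pi> y \<in> V}"
    and sm: "smooth_map_on (prod_mfd B MG) Q (V \<times> carrier G) \<Phi>"
      "smooth_map_on Q (prod_mfd B MG) {y \<in> pts Q. \<pi> y \<in> V} (inv_into (V \<times> carrier G) \<Phi>)"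
    and fib: "\<forall>s\<in>V. \<forall>g\<in>carrier G. \<pi> (\<Phi> (s, g)) = s"
    using symmetry(3)[unfolded principal_bundle_def Let_def, THEN conjunct2, THEN conjunct2,
        THEN conjunct2, THEN bspec, OF \<open>\<pi> x \<in> pts B\<close>]
    by (elim exE conjE) (rule that, assumption+, blast)
  let ?\<Psi> = "inv_into (V \<times> carrier G) \<Phi>"
  have \<Psi>: "?\<Psi> y \<in> V \<times> carrier G" "\<Phi> (?\<Psi> y) = y" if "y \<in> pts Q" "\<pi> y \<in> V" for y
    using bij that by (auto simp: bij_betw_def intro: inv_into_into f_inv_into_f)
  have \<Psi>1: "fst (?\<Psi> y) = \<pi> y" if "y \<in> pts Q" "\<pi> y \<in> V" for y
    using \<Psi>[OF that] fib by (cases "?\<Psi> y") auto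
  obtain s k where sk: "?\<Psi> x = (s, k)" by (cases "?\<Psi> x")
  have k: "s = \<pi> x" "k \<in> carrier G" "\<Phi> (s, k) = x"
    using \<Psi>1[OF x V(2)] \<Psi>[OF x V(2)] sk by auto
  have "\<Phi> (s, g) \<in> pts Q" if "s \<in> V" "g \<in> carrier G" for s g
    using bij that by (auto simp: bij_betw_def)
  then show thesis
    by (intro that[of V k \<Phi> ?\<Psi>] V sm) (use \<Psi> \<Psi>1 sk k fib in simp_all)
qed

text \<open>
  Fixing the group coordinate in a trivialization gives a section through \<open>x\<close>. It witnesses that
  \<open>d\<pi>\<close> is onto, and turns differentiability of \<open>Lb \<circ> (\<pi> \<times> \<pi>)\<close> into differentiability of \<open>Lb\<close>.
\<close>

lemma local_section:
  assumes x: "x \<in> pts Q"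
  obtains V \<sigma> \<sigma>' where "openin (topo B) V" "\<pi> x \<in> V" "\<sigma> (\<pi> x) = x"
    "\<forall>s\<in>V. \<sigma> s \<in> pts Q \<and> \<pi> (\<sigma> s) = s"
    "has_chart_derivative (chart_at B (\<pi> x)) (chart_at Q x) \<sigma> (\<pi> x) \<sigma>'"
    "\<forall>\<delta>. mfderiv Q B \<pi> x (\<sigma>' \<delta>) = \<delta>"
proof -
  obtain V k \<Phi> \<Psi> where V: "openin (topo B) V" "\<pi> x \<in> V"
    and k: "k \<in> carrier G" "\<Phi> (\<pi> x, k) = x" "\<Psi> x = (\<pi> x, k)"
    and sm: "smooth_map_on (prod_mfd B MG) Q (V \<times> carrier G) \<Phi>"
      "smooth_map_on Q (prod_mfd B MG) {y \<in> pts Q. \<pi> y \<in> V} \<Psi>"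
    and \<Psi>: "\<forall>y\<in>pts Q. \<pi> y \<in> V \<longrightarrow> \<Phi> (\<Psi> y) = y \<and> fst (\<Psi> y) = \<pi> y"
    and fib: "\<forall>s\<in>V. \<forall>g\<in>carrier G. \<Phi> (s, g) \<in> pts Q \<and> \<pi> (\<Phi> (s, g)) = s"
    by (rule local_trivialization[OF x], rule that)
  have px: "\<pi> x \<in> pts B" and kM: "k \<in> pts MG" using x k by (simp_all add: symmetry(7))
  obtain \<Phi>' where "has_chart_derivative (prod_chart (chart_at B (\<pi> x)) (chart_at MG k)) (chart_at Q x) \<Phi> (\<pi> x, k) \<Phi>'"
    using smooth_map_on_derivative_from_prod[OF symmetry(6,5,4) sm(1), of "\<pi> x" k] V k by auto
  then have \<sigma>: "has_chart_derivative (chart_at B (\<pi> x)) (chart_at Q x) (\<lambda>s. \<Phi> (s, k)) (\<pi> x) (\<lambda>\<delta>. \<Phi>' (\<delta>, 0))"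
    by (rule has_chart_derivative_compose[OF chart_B(3)[OF px]
        chart_setD(2)[OF chart_set_prod[OF chart_B(2)[OF px] chart_MG(2)[OF kM]]]
        has_chart_derivative_Pair[OF has_chart_derivative_id[OF chart_B(2)[OF px] chart_B(5)[OF px]]
          has_chart_derivative_const[OF chart_B(5)[OF px] chart_MG(5)[OF kM]]]])
  have "has_chart_derivative (chart_at B (\<pi> x)) (chart_at B (\<pi> x)) (\<lambda>s. \<pi> (\<Phi> (s, k))) (\<pi> x)
      (\<lambda>\<delta>. mfderiv Q B \<pi> x (\<Phi>' (\<delta>, 0)))"
    by (rule has_chart_derivative_compose[OF chart_B(3)[OF px] chart_Q(3)[OF x] \<sigma>])
      (use proj_derivative[OF x] k in simp)
  then have "has_chart_derivative (chart_at B (\<pi> x)) (chart_at B (\<pi> x)) (\<lambda>s. s) (\<pi> x)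
      (\<lambda>\<delta>. mfderiv Q B \<pi> x (\<Phi>' (\<delta>, 0)))"
    by (rule has_chart_derivative_cong[OF chart_B(2)[OF px] V, rotated]) (use fib k in simp)
  from has_chart_derivative_unique[OF this has_chart_derivative_id[OF chart_B(2)[OF px] chart_B(5)[OF px]]]
  have "mfderiv Q B \<pi> x (\<Phi>' (\<delta>, 0)) = \<delta>" for \<delta> by (rule fun_cong)
  then show thesis
    by (intro that[of V "\<lambda>s. \<Phi> (s, k)" "\<lambda>\<delta>. \<Phi>' (\<delta>, 0)"] V \<sigma>) (use k fib in simp_all)
qed

text \<open>
  The projection is constant along a curve in an orbit.
\<close>

lemma vertical_in_kernel:
  assumes x: "x \<in> pts Q" and v: "v \<in> vertical_space Q G l x"
  shows "mfderiv Q B \<pi> x v = 0"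
proof -
  obtain c \<epsilon> where c: "v = mfderiv real_mfd Q c 0 1" "c 0 = x" "\<epsilon> > 0"
    "smooth_map_on real_mfd Q {-\<epsilon><..<\<epsilon>} c" "c ` {-\<epsilon><..<\<epsilon>} \<subseteq> \<pi> x"
    using v unfolding vertical_space_def tangent_space_def by auto
  obtain c' where c': "has_chart_derivative (UNIV, id) (chart_at Q x) c 0 c'"
    using smooth_map_on_derivative[OF smooth_manifold_real_mfd symmetry(4) c(4), of 0] c(2,3)
    by (auto simp: real_chart)
  then have v_eq: "v = c' 1"
    using mfderiv_eq[where M = real_mfd and N = Q and f = c and p = 0 and f' = c'] by (simp add: real_chart c)
  have deriv: "has_chart_derivative (UNIV, id) (chart_at B (\<pi> x)) (\<lambda>t. \<pi> (c t)) 0 (\<lambda>t. mfderiv Q B \<pi> x (c' t))"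
    by (rule has_chart_derivative_compose[OF _ chart_Q(3)[OF x] c']) (use proj_derivative[OF x] c(2) in simp_all)
  have orb: "\<pi> (c t) = \<pi> x" if "t \<in> {-\<epsilon><..<\<epsilon>}" for t
  proof -
    have "c t \<in> \<pi> x" using c(5) that by blast
    then obtain g where "g \<in> carrier G" "c t = l g x" unfolding orbit_def by blast
    then show ?thesis using x by simp
  qed
  have "openin (topo real_mfd) {-\<epsilon><..<\<epsilon>}" by (simp add: real_mfd_def)
  then have "has_chart_derivative (UNIV, id) (chart_at B (\<pi> x)) (\<lambda>t. \<pi> x) 0 (\<lambda>t. mfderiv Q B \<pi> x (c' t))"
    by (rule has_chart_derivative_cong[OF real_chart(2) _ _ orb deriv]) (use c(3) in simp_all)
  moreover have "has_chart_derivative (UNIV, id) (chart_at B (\<pi> x)) (\<lambda>t::real. \<pi> x) 0 (\<lambda>t. 0)"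
    using chart_B(5)[of "\<pi> x"] x by (intro has_chart_derivative_const) auto
  ultimately have "(\<lambda>t. mfderiv Q B \<pi> x (c' t)) = (\<lambda>t. 0)" by (rule has_chart_derivative_unique)
  then show ?thesis unfolding v_eq by (rule fun_cong)
qed

text \<open>
  In a trivialization a vector killed by \<open>d\<pi>\<close> has the form \<open>(0, w)\<close>. The image under \<open>\<Phi>\<close> of the
  coordinate line in direction \<open>(0, w)\<close> is a smooth curve inside the orbit with that velocity.
\<close>

lemma kernel_vertical:
  assumes x: "x \<in> pts Q" and v: "mfderiv Q B \<pi> x v = 0"
  shows "v \<in> vertical_space Q G l x"
proof -
  obtain V k \<Phi> \<Psi> where V: "openin (topo B) V" "\<pi> x \<in> V"
    and k: "k \<in> carrier G" "\<Phi> (\<pi> x, k) = x" "\<Psi> x = (\<pi> x, k)"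
    and sm: "smooth_map_on (prod_mfd B MG) Q (V \<times> carrier G) \<Phi>"
      "smooth_map_on Q (prod_mfd B MG) {y \<in> pts Q. \<pi> y \<in> V} \<Psi>"
    and \<Psi>: "\<forall>y\<in>pts Q. \<pi> y \<in> V \<longrightarrow> \<Phi> (\<Psi> y) = y \<and> fst (\<Psi> y) = \<pi> y"
    and fib: "\<forall>s\<in>V. \<forall>g\<in>carrier G. \<Phi> (s, g) \<in> pts Q \<and> \<pi> (\<Phi> (s, g)) = s"
    by (rule local_trivialization[OF x], rule that)
  have px: "\<pi> x \<in> pts B" and kM: "k \<in> pts MG" using x k by (simp_all add: symmetry(7))
  let ?KB = "chart_at B (\<pi> x)" and ?KG = "chart_at MG k"
  define K where "K = prod_chart ?KB ?KG"
  let ?i = "inv_into (fst K) (snd K)"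
  have K: "K \<in> chart_set (prod_mfd B MG)" "K \<in> atlas (prod_mfd B MG)" "(\<pi> x, k) \<in> fst K"
    unfolding K_def using chart_B[OF px] chart_MG[OF kM]
    by (simp_all add: chart_set_prod prod_chart_atlas) (simp add: prod_chart_def)
  obtain \<Phi>' where \<Phi>': "has_chart_derivative K (chart_at Q x) \<Phi> (\<pi> x, k) \<Phi>'"
    using smooth_map_on_derivative_from_prod[OF symmetry(6,5,4) sm(1), of "\<pi> x" k] V k by (auto simp: K_def)
  have P: "openin (topo Q) {y \<in> pts Q. \<pi> y \<in> V}" using sm(2) by (simp add: smooth_map_on_def)
  have xP: "x \<in> {y \<in> pts Q. \<pi> y \<in> V}" using x V by simp
  obtain \<Psi>' where \<Psi>': "has_chart_derivative (chart_at Q x) K \<Psi> x \<Psi>'"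
    using smooth_map_on_derivative_to_prod[OF symmetry(4,6,5) sm(2) xP k(3)] by (auto simp: K_def)
  have "has_chart_derivative (chart_at Q x) (chart_at Q x) (\<lambda>y. \<Phi> (\<Psi> y)) x (\<lambda>w. \<Phi>' (\<Psi>' w))"
    by (rule has_chart_derivative_compose[OF chart_Q(3)[OF x] chart_setD(2)[OF K(1)] \<Psi>']) (use \<Phi>' k in simp)
  then have "has_chart_derivative (chart_at Q x) (chart_at Q x) (\<lambda>y. y) x (\<lambda>w. \<Phi>' (\<Psi>' w))"
    by (rule has_chart_derivative_cong[OF chart_Q(2)[OF x] P xP, rotated]) (use \<Psi> in simp)
  from has_chart_derivative_unique[OF this has_chart_derivative_id[OF chart_Q(2)[OF x] chart_Q(5)[OF x]]]
  have \<Phi>\<Psi>: "\<Phi>' (\<Psi>' v) = v" by (rule fun_cong)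
  have "has_chart_derivative (chart_at Q x) ?KB (\<lambda>y. fst (\<Psi> y)) x (\<lambda>w. fst (\<Psi>' w))"
    by (rule has_chart_derivative_compose[OF chart_Q(3)[OF x] chart_setD(2)[OF K(1)] \<Psi>'])
      (use has_chart_derivative_fst_snd(1)[OF chart_B(2)[OF px] chart_MG(2)[OF kM] chart_B(5)[OF px] chart_MG(5)[OF kM]]
        in \<open>simp add: k K_def\<close>)
  then have "has_chart_derivative (chart_at Q x) ?KB \<pi> x (\<lambda>w. fst (\<Psi>' w))"
    by (rule has_chart_derivative_cong[OF chart_Q(2)[OF x] P xP, rotated]) (use \<Psi> in simp)
  from has_chart_derivative_unique[OF this proj_derivative[OF x]]
  have "fst (\<Psi>' v) = mfderiv Q B \<pi> x v" by (rule fun_cong)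
  then obtain w where w: "\<Psi>' v = (0, w)" using v by (cases "\<Psi>' v") auto
  have xk: "(\<pi> x, k) \<in> V \<times> carrier G" using V k by simp
  let ?c = "\<lambda>t::real. \<Phi> (?i (snd K (\<pi> x, k) + t *\<^sub>R (0, w)))"
  obtain \<epsilon> where \<epsilon>: "\<epsilon> > 0" "smooth_map_on real_mfd Q {-\<epsilon><..<\<epsilon>} ?c"
    "\<forall>t\<in>{-\<epsilon><..<\<epsilon>}. snd K (\<pi> x, k) + t *\<^sub>R (0, w) \<in> snd K ` ((V \<times> carrier G) \<inter> fst K)"
    by (rule smooth_map_on_line[OF symmetry(4) sm(1) K(2,1) xk K(3)], rule that)
  have c0: "?c 0 = x" using chart_setD(4)[OF K(1,3)] k by (simp add: zero_prod_def[symmetric])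
  \<comment> \<open>Injectivity of the chart of \<open>B\<close> recovers from a constant first coordinate that the curve stays over \<open>\<pi> x\<close>.\<close>
  have c_orbit: "?c t \<in> \<pi> x" if t: "t \<in> {-\<epsilon><..<\<epsilon>}" for t
  proof -
    obtain z where z: "snd K (\<pi> x, k) + t *\<^sub>R (0, w) = snd K z" "z \<in> (V \<times> carrier G) \<inter> fst K"
      by (rule imageE[OF bspec[OF \<epsilon>(3) t]])
    obtain s g where "z = (s, g)" by (cases z)
    with z have sg: "(s, g) \<in> V \<times> carrier G" "(s, g) \<in> fst K"
      "snd K (\<pi> x, k) + t *\<^sub>R (0, w) = snd K (s, g)"
      by blast+
    have "snd ?KB s = snd ?KB (\<pi> x)" using sg(3) by (simp add: K_def prod_chart_def)
    moreover have "s \<in> fst ?KB" using sg(2) by (simp add: K_def prod_chart_def)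
    ultimately have "s = \<pi> x"
      using chart_B(3)[OF px] chart_B(5)[OF px] by (auto dest: inj_onD)
    moreover have "?c t = \<Phi> (s, g)" using sg(3) chart_setD(4)[OF K(1) sg(2)] by simp
    ultimately have "?c t \<in> pts Q" "\<pi> (?c t) = \<pi> x" using fib sg(1) by auto
    then show ?thesis using in_proj by metis
  qed
  have "has_chart_derivative (UNIV, id) (chart_at Q x) ?c 0 (\<lambda>t. \<Phi>' (t *\<^sub>R (0, w)))"
    by (rule has_chart_derivative_compose[OF _ chart_setD(2)[OF K(1)] has_chart_derivative_line[OF K(1,3)]])
      (use \<Phi>' chart_setD(4)[OF K(1,3)] in \<open>simp_all add: zero_prod_def[symmetric]\<close>)
  then have "mfderiv real_mfd Q ?c 0 = (\<lambda>t. \<Phi>' (t *\<^sub>R (0, w)))"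
    by (intro mfderiv_eq) (use c0 in \<open>simp add: real_chart\<close>)
  then have "v = mfderiv real_mfd Q ?c 0 1" using \<Phi>\<Psi> w by simp
  moreover have "?c ` {-\<epsilon><..<\<epsilon>} \<subseteq> \<pi> x" using c_orbit by blast
  ultimately show ?thesis
    unfolding vertical_space_def tangent_space_def using c0 \<epsilon>(1,2) by blast
qed

lemma D_subspace: "x \<in> pts Q \<Longrightarrow> subspace (D x)"
  using vertical_complement by (simp add: direct_sum_def)

lemma hor_lift_unique:
  assumes x: "x \<in> pts Q" and "v \<in> D x" "w \<in> D x" "mfderiv Q B \<pi> x v = mfderiv Q B \<pi> x w"
  shows "v = w"
proof -
  have "v - w \<in> vertical_space Q G l x"
    using assms by (intro kernel_vertical) (simp_all add: linear_diff[OF linear_mfderiv_proj])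
  moreover have "v - w \<in> D x" using assms D_subspace subspace_diff by blast
  ultimately have "v - w \<in> {0}" using vertical_complement[OF x] unfolding direct_sum_def by blast
  then show ?thesis by simp
qed

lemma hor_lift_eqI:
  assumes "x \<in> pts Q" "v \<in> D x" "mfderiv Q B \<pi> x v = \<delta>"
  shows "h x \<delta> = v"
  unfolding h hor_lift_def using assms hor_lift_unique by (intro the_equality) auto

text \<open>
  Subtracting from any preimage under \<open>d\<pi>\<close> its vertical part leaves a preimage in \<open>D\<close>.
\<close>

lemma hor_lift:
  assumes x: "x \<in> pts Q"
  shows "h x \<delta> \<in> D x" "mfderiv Q B \<pi> x (h x \<delta>) = \<delta>"
proof -
  obtain u where u: "mfderiv Q B \<pi> x u = \<delta>"
    by (rule local_section[OF x], rule that, erule spec)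
  have "u \<in> {v + w | v w. v \<in> vertical_space Q G l x \<and> w \<in> D x}"
    using vertical_complement[OF x] unfolding direct_sum_def by blast
  then obtain v w where vw: "u = v + w" "v \<in> vertical_space Q G l x" "w \<in> D x" by blast
  then have "mfderiv Q B \<pi> x w = \<delta>"
    using u vertical_in_kernel[OF x vw(2)] linear_add[OF linear_mfderiv_proj[OF x]] by simp
  then have "h x \<delta> = w" by (rule hor_lift_eqI[OF x vw(3)])
  then show "h x \<delta> \<in> D x" "mfderiv Q B \<pi> x (h x \<delta>) = \<delta>"
    using \<open>mfderiv Q B \<pi> x w = \<delta>\<close> vw by auto
qed

text \<open>
  The image of the lift under the tangent map of \<open>l g\<close> is in \<open>D\<close> by invariance and has the same
  projection, which characterizes the lift at \<open>l g x\<close>.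
\<close>

lemma hor_lift_l:
  assumes g: "g \<in> carrier G" and x: "x \<in> pts Q"
  shows "h (l g x) \<delta> = mfderiv Q Q (l g) x (h x \<delta>)"
proof (rule hor_lift_eqI)
  show "l g x \<in> pts Q" using assms by simp
  show "mfderiv Q Q (l g) x (h x \<delta>) \<in> D (l g x)"
    using D_invariant[OF g x] hor_lift(1)[OF x] by blast
  show "mfderiv Q B \<pi> (l g x) (mfderiv Q Q (l g) x (h x \<delta>)) = \<delta>"
    using proj_l_derivative[OF g x] hor_lift(2)[OF x] by simp
qed

section \<open>The derivative of the reduced Lagrangian\<close>

lemmas one_chart = chart_MG[OF one_pts]

text \<open>
  Differentiating \<open>g \<otimes> inv g = e\<close> at \<open>e\<close>, where the derivative of the product is the sum.
\<close>

lemma inverse_derivative: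
  "has_chart_derivative (chart_at MG \<one>\<^bsub>G\<^esub>) (chart_at MG \<one>\<^bsub>G\<^esub>) (\<lambda>g. inv\<^bsub>G\<^esub> g) \<one>\<^bsub>G\<^esub> uminus"
proof -
  let ?K = "chart_at MG \<one>\<^bsub>G\<^esub>"
  have open_G: "openin (topo MG) (carrier G)" using symmetry(7) openin_topspace by metis
  have inj: "inj_on (snd (prod_chart ?K ?K)) (fst (prod_chart ?K ?K))"
    by (rule chart_setD(2)[OF chart_set_prod[OF one_chart(2) one_chart(2)]])
  have sm: "smooth_map_on (prod_mfd MG MG) MG (carrier G \<times> carrier G) (\<lambda>z. fst z \<otimes>\<^bsub>G\<^esub> snd z)"
    "smooth_map_on MG MG (carrier G) (\<lambda>g. inv\<^bsub>G\<^esub> g)"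
    using symmetry(1) by (simp_all add: lie_group_def case_prod_beta')
  obtain m' where m': "has_chart_derivative (prod_chart ?K ?K) ?K (\<lambda>z. fst z \<otimes>\<^bsub>G\<^esub> snd z) (\<one>\<^bsub>G\<^esub>, \<one>\<^bsub>G\<^esub>) m'"
    using smooth_map_on_derivative_from_prod[OF symmetry(5,5,5) sm(1), of "\<one>\<^bsub>G\<^esub>" "\<one>\<^bsub>G\<^esub>"] by auto
  obtain i' where i': "has_chart_derivative ?K ?K (\<lambda>g. inv\<^bsub>G\<^esub> g) \<one>\<^bsub>G\<^esub> i'"
    using smooth_map_on_derivative[OF symmetry(5,5) sm(2), of "\<one>\<^bsub>G\<^esub>"] by auto
  note id = has_chart_derivative_id[OF one_chart(2) one_chart(5)]
  note const = has_chart_derivative_const[OF one_chart(5) one_chart(5)]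
  have lin: "linear m'" by (rule has_chart_derivative_linear[OF m'])
  have "has_chart_derivative ?K ?K (\<lambda>g. fst (g, \<one>\<^bsub>G\<^esub>) \<otimes>\<^bsub>G\<^esub> snd (g, \<one>\<^bsub>G\<^esub>)) \<one>\<^bsub>G\<^esub> (\<lambda>u. m' (u, 0))"
    by (rule has_chart_derivative_compose[OF one_chart(3) inj has_chart_derivative_Pair[OF id const] m'])
  then have "has_chart_derivative ?K ?K (\<lambda>g. g) \<one>\<^bsub>G\<^esub> (\<lambda>u. m' (u, 0))"
    by (rule has_chart_derivative_cong[OF one_chart(2) open_G, rotated 2]) simp_all
  from has_chart_derivative_unique[OF this id] have m1: "m' (u, 0) = u" for u by (rule fun_cong)
  have "has_chart_derivative ?K ?K (\<lambda>g. fst (\<one>\<^bsub>G\<^esub>, g) \<otimes>\<^bsub>G\<^esub> snd (\<one>\<^bsub>G\<^esub>, g)) \<one>\<^bsub>G\<^esub> (\<lambda>u. m' (0, u))"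
    by (rule has_chart_derivative_compose[OF one_chart(3) inj has_chart_derivative_Pair[OF const id] m'])
  then have "has_chart_derivative ?K ?K (\<lambda>g. g) \<one>\<^bsub>G\<^esub> (\<lambda>u. m' (0, u))"
    by (rule has_chart_derivative_cong[OF one_chart(2) open_G, rotated 2]) simp_all
  from has_chart_derivative_unique[OF this id] have m2: "m' (0, u) = u" for u by (rule fun_cong)
  have "has_chart_derivative ?K ?K (\<lambda>g. fst (g, inv\<^bsub>G\<^esub> g) \<otimes>\<^bsub>G\<^esub> snd (g, inv\<^bsub>G\<^esub> g)) \<one>\<^bsub>G\<^esub> (\<lambda>u. m' (u, i' u))"
    by (rule has_chart_derivative_compose[OF one_chart(3) inj has_chart_derivative_Pair[OF id i']])
      (use m' in simp)
  then have "has_chart_derivative ?K ?K (\<lambda>g. \<one>\<^bsub>G\<^esub>) \<one>\<^bsub>G\<^esub> (\<lambda>u. m' (u, i' u))"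
    by (rule has_chart_derivative_cong[OF one_chart(2) open_G, rotated 2]) simp_all
  from has_chart_derivative_unique[OF this const] have m3: "m' (u, i' u) = 0" for u by (rule fun_cong)
  have "i' u = - u" for u
    using linear_add[OF lin, of "(u, 0)" "(0, i' u)"] m1[of u] m2[of "i' u"] m3[of u]
    by (simp add: add_eq_0_iff)
  then have "i' = uminus" by (simp add: fun_eq_iff)
  with i' show ?thesis by simp
qed

text \<open>
  The map \<open>\<Lambda>\<close> is the infinitesimal action at \<open>x\<close>. The derivative of \<open>(g, y) \<mapsto> l (inv g) y\<close> has the
  partial derivatives \<open>-\<Lambda>\<close>, because inversion has derivative \<open>-1\<close>, and the identity, because
  \<open>l e\<close> is the identity.
\<close>

lemma action_derivative_at_one:
  assumes x: "x \<in> pts Q"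
  obtains \<Lambda> where "has_chart_derivative (chart_at MG \<one>\<^bsub>G\<^esub>) (chart_at Q x) (\<lambda>g. l g x) \<one>\<^bsub>G\<^esub> \<Lambda>"
    "has_chart_derivative (prod_chart (chart_at MG \<one>\<^bsub>G\<^esub>) (chart_at Q x)) (chart_at Q x)
      (\<lambda>z. l (inv\<^bsub>G\<^esub> (fst z)) (snd z)) (\<one>\<^bsub>G\<^esub>, x) (\<lambda>v. snd v - \<Lambda> (fst v))"
proof -
  let ?K = "chart_at MG \<one>\<^bsub>G\<^esub>" and ?H = "chart_at Q x"
  have prod: "prod_chart ?K ?H \<in> chart_set (prod_mfd MG Q)"
    by (rule chart_set_prod[OF one_chart(2) chart_Q(2)[OF x]])
  note inj = chart_setD(2)[OF prod]
  obtain l' where l': "has_chart_derivative (prod_chart ?K ?H) ?H (\<lambda>z. l (fst z) (snd z)) (\<one>\<^bsub>G\<^esub>, x) l'"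
    using action_derivative[of "\<one>\<^bsub>G\<^esub>" x] x by auto
  have lin: "linear l'" by (rule has_chart_derivative_linear[OF l'])
  note idQ = has_chart_derivative_id[OF chart_Q(2)[OF x] chart_Q(5)[OF x]]
  have "has_chart_derivative ?K ?H (\<lambda>g. l (fst (g, x)) (snd (g, x))) \<one>\<^bsub>G\<^esub> (\<lambda>u. l' (u, 0))"
    by (rule has_chart_derivative_compose[OF one_chart(3) inj has_chart_derivative_Pair[OF
      has_chart_derivative_id[OF one_chart(2) one_chart(5)]
      has_chart_derivative_const[OF one_chart(5) chart_Q(5)[OF x]]] l'])
  then have 1: "has_chart_derivative ?K ?H (\<lambda>g. l g x) \<one>\<^bsub>G\<^esub> (\<lambda>u. l' (u, 0))" by simp
  have "has_chart_derivative ?H ?H (\<lambda>y. l (fst (\<one>\<^bsub>G\<^esub>, y)) (snd (\<one>\<^bsub>G\<^esub>, y))) x (\<lambda>w. l' (0, w))"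
    by (rule has_chart_derivative_compose[OF chart_Q(3)[OF x] inj has_chart_derivative_Pair[OF
      has_chart_derivative_const[OF chart_Q(5)[OF x] one_chart(5)] idQ] l'])
  then have "has_chart_derivative ?H ?H (\<lambda>y. y) x (\<lambda>w. l' (0, w))"
    by (rule has_chart_derivative_cong[OF chart_Q(2)[OF x] openin_topspace x, rotated]) simp
  from has_chart_derivative_unique[OF this idQ] have l2: "l' (0, w) = w" for w by (rule fun_cong)
  have "has_chart_derivative (prod_chart ?K ?H) ?H
      (\<lambda>z. l (fst (inv\<^bsub>G\<^esub> (fst z), snd z)) (snd (inv\<^bsub>G\<^esub> (fst z), snd z))) (\<one>\<^bsub>G\<^esub>, x) (\<lambda>v. l' (- fst v, snd v))"
    by (rule has_chart_derivative_compose[OF inj inj has_chart_derivative_prod_map[OF one_chart(2)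
      chart_Q(2)[OF x] one_chart(5) chart_Q(5)[OF x] inverse_derivative idQ]]) (use l' in simp)
  moreover have "l' (- u, w) = w - l' (u, 0)" for u w
    using linear_diff[OF lin, of "(0, w)" "(u, 0)"] l2[of w] by simp
  ultimately show thesis by (intro that[OF 1]) simp
qed

text \<open>
  Differentiates \<open>Lb_proj\<close> at a horizontal pair. On the right the second point has the velocity
  \<open>w - \<Lambda> (dAd (v, w))\<close>, and the correction \<open>D\<^sub>2L (\<Lambda> (dAd (v, w)))\<close> is precisely the force term.
\<close>

lemma reduced_derivative:
  assumes ab: "horizontal_pair a b"
  shows "\<exists>L'. has_chart_derivative (prod_chart (chart_at B (\<pi> a)) (chart_at B (\<pi> b))) (UNIV, id) Lb (\<pi> a, \<pi> b) L'"
    and "partial1 B real_mfd Lb (\<pi> a, \<pi> b) (mfderiv Q B \<pi> a v) +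
      mfderiv MG real_mfd (\<lambda>w. L (a, l w b)) \<one>\<^bsub>G\<^esub> (partial1 Q MG Ad (a, b) v) = partial1 Q real_mfd L (a, b) v"
    and "partial2 B real_mfd Lb (\<pi> a, \<pi> b) (mfderiv Q B \<pi> b v) +
      mfderiv MG real_mfd (\<lambda>w. L (a, l w b)) \<one>\<^bsub>G\<^esub> (partial2 Q MG Ad (a, b) v) = partial2 Q real_mfd L (a, b) v"
proof -
  note a = horizontal_pair_pts(1)[OF ab] and b = horizontal_pair_pts(2)[OF ab]
  have dom: "(a, b) \<in> dom_Ad" and Ad_ab: "Ad (a, b) = \<one>\<^bsub>G\<^esub>" using ab by (auto simp: horizontal_pair_def)
  note pa = proj_pts[OF a] and pb = proj_pts[OF b]
  let ?Ka = "chart_at Q a" and ?Kb = "chart_at Q b" and ?Ha = "chart_at B (\<pi> a)" and ?Hb = "chart_at B (\<pi> b)"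
  let ?K1 = "chart_at MG \<one>\<^bsub>G\<^esub>"
  define K where "K = prod_chart ?Ka ?Kb"
  define H where "H = prod_chart ?Ha ?Hb"
  have K: "K \<in> chart_set (prod_mfd Q Q)" and H: "H \<in> chart_set (prod_mfd B B)"
    unfolding K_def H_def by (intro chart_set_prod chart_Q chart_B a b pa pb)+
  have fsQ: "has_chart_derivative K ?Ka fst (a, b) fst" "has_chart_derivative K ?Kb snd (a, b) snd"
    unfolding K_def by (rule has_chart_derivative_fst_snd[OF chart_Q(2)[OF a] chart_Q(2)[OF b] chart_Q(5)[OF a] chart_Q(5)[OF b]])+
  obtain L' where L': "has_chart_derivative K (UNIV, id) L (a, b) L'"
    using L_derivative[OF a b] by (auto simp: K_def)
  obtain A' where A': "has_chart_derivative K ?K1 Ad (a, b) A'"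
    using smooth_map_on_derivative_from_prod[OF symmetry(4,4,5) Ad_smooth dom] by (auto simp: K_def Ad_ab)
  obtain \<Lambda> where \<Lambda>: "has_chart_derivative ?K1 ?Kb (\<lambda>g. l g b) \<one>\<^bsub>G\<^esub> \<Lambda>"
    "has_chart_derivative (prod_chart ?K1 ?Kb) ?Kb (\<lambda>z. l (inv\<^bsub>G\<^esub> (fst z)) (snd z)) (\<one>\<^bsub>G\<^esub>, b) (\<lambda>v. snd v - \<Lambda> (fst v))"
    by (rule action_derivative_at_one[OF b])
  have linL: "linear L'" by (rule has_chart_derivative_linear[OF L'])

  \<comment> \<open>The right-hand side of \<open>Lb_proj\<close>, built up by the chain rule.\<close>
  have "has_chart_derivative K ?Kb (\<lambda>z. l (inv\<^bsub>G\<^esub> (fst (Ad z, snd z))) (snd (Ad z, snd z))) (a, b)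
      (\<lambda>v. snd (A' v, snd v) - \<Lambda> (fst (A' v, snd v)))"
    by (rule has_chart_derivative_compose[OF chart_setD(2)[OF K]
        chart_setD(2)[OF chart_set_prod[OF one_chart(2) chart_Q(2)[OF b]]] has_chart_derivative_Pair[OF A' fsQ(2)]])
      (use \<Lambda>(2) Ad_ab in simp)
  then have "has_chart_derivative K ?Kb (\<lambda>z. l (inv\<^bsub>G\<^esub> (Ad z)) (snd z)) (a, b) (\<lambda>v. snd v - \<Lambda> (A' v))"
    by simp
  from has_chart_derivative_Pair[OF fsQ(1) this]
  have "has_chart_derivative K K (\<lambda>z. (fst z, l (inv\<^bsub>G\<^esub> (Ad z)) (snd z))) (a, b) (\<lambda>v. (fst v, snd v - \<Lambda> (A' v)))"
    by (simp add: K_def)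
  then have "has_chart_derivative K (UNIV, id) (\<lambda>z. L (fst z, l (inv\<^bsub>G\<^esub> (Ad z)) (snd z))) (a, b)
      (\<lambda>v. L' (fst v, snd v - \<Lambda> (A' v)))"
    by (rule has_chart_derivative_compose[OF chart_setD(2)[OF K] chart_setD(2)[OF K]]) (use L' Ad_ab b in simp)
  then have LbQ: "has_chart_derivative K (UNIV, id) (\<lambda>z. Lb (\<pi> (fst z), \<pi> (snd z))) (a, b)
      (\<lambda>v. L' (fst v, snd v - \<Lambda> (A' v)))"
  proof (rule has_chart_derivative_cong[OF K _ dom, rotated 2])
    show "openin (topo (prod_mfd Q Q)) dom_Ad" using Ad_smooth by (simp add: smooth_map_on_def)
    fix z assume "z \<in> dom_Ad"
    then show "L (fst z, l (inv\<^bsub>G\<^esub> (Ad z)) (snd z)) = Lb (\<pi> (fst z), \<pi> (snd z))"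
      using Lb_proj by (cases z) simp
  qed

  \<comment> \<open>Composed with sections, the pullback of \<open>Lb\<close> gives back \<open>Lb\<close>, which is therefore differentiable.\<close>
  obtain V \<sigma> \<sigma>' where \<sigma>: "openin (topo B) V" "\<pi> a \<in> V" "\<sigma> (\<pi> a) = a" "\<forall>s\<in>V. \<sigma> s \<in> pts Q \<and> \<pi> (\<sigma> s) = s"
    "has_chart_derivative ?Ha ?Ka \<sigma> (\<pi> a) \<sigma>'" by (rule local_section[OF a], rule that)
  obtain W \<tau> \<tau>' where \<tau>: "openin (topo B) W" "\<pi> b \<in> W" "\<tau> (\<pi> b) = b" "\<forall>s\<in>W. \<tau> s \<in> pts Q \<and> \<pi> (\<tau> s) = s"
    "has_chart_derivative ?Hb ?Kb \<tau> (\<pi> b) \<tau>'" by (rule local_section[OF b], rule that)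
  have "has_chart_derivative H K (\<lambda>s. (\<sigma> (fst s), \<tau> (snd s))) (\<pi> a, \<pi> b) (\<lambda>v. (\<sigma>' (fst v), \<tau>' (snd v)))"
    unfolding H_def K_def by (rule has_chart_derivative_prod_map[OF chart_B(2)[OF pa] chart_B(2)[OF pb]
        chart_B(5)[OF pa] chart_B(5)[OF pb] \<sigma>(5) \<tau>(5)])
  from has_chart_derivative_compose[OF chart_setD(2)[OF H] chart_setD(2)[OF K] this] LbQ \<sigma>(3) \<tau>(3)
  obtain R' where "has_chart_derivative H (UNIV, id) (\<lambda>s. Lb (\<pi> (\<sigma> (fst s)), \<pi> (\<tau> (snd s)))) (\<pi> a, \<pi> b) R'"
    by fastforce
  then have Lb': "has_chart_derivative H (UNIV, id) Lb (\<pi> a, \<pi> b) R'"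
  proof (rule has_chart_derivative_cong[OF H, rotated 3])
    show "openin (topo (prod_mfd B B)) (V \<times> W)"
      using \<sigma>(1) \<tau>(1) by (simp add: prod_mfd_def openin_prod_Times_iff)
    show "(\<pi> a, \<pi> b) \<in> V \<times> W" using \<sigma>(2) \<tau>(2) by simp
    fix s assume "s \<in> V \<times> W"
    then show "Lb (\<pi> (\<sigma> (fst s)), \<pi> (\<tau> (snd s))) = Lb s" using \<sigma>(4) \<tau>(4) by auto
  qed
  then show "\<exists>L'. has_chart_derivative (prod_chart ?Ha ?Hb) (UNIV, id) Lb (\<pi> a, \<pi> b) L'"
    unfolding H_def by (rule exI[where x = R'])

  \<comment> \<open>A second computation of the derivative of the pullback, through the derivative \<open>R'\<close> of \<open>Lb\<close>.\<close>
  have "has_chart_derivative K H (\<lambda>z. (\<pi> (fst z), \<pi> (snd z))) (a, b)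
      (\<lambda>v. (mfderiv Q B \<pi> a (fst v), mfderiv Q B \<pi> b (snd v)))"
    unfolding H_def K_def by (rule has_chart_derivative_prod_map[OF chart_Q(2)[OF a] chart_Q(2)[OF b]
        chart_Q(5)[OF a] chart_Q(5)[OF b] proj_derivative[OF a] proj_derivative[OF b]])
  then have "has_chart_derivative K (UNIV, id) (\<lambda>z. Lb (\<pi> (fst z), \<pi> (snd z))) (a, b)
      (\<lambda>v. R' (mfderiv Q B \<pi> a (fst v), mfderiv Q B \<pi> b (snd v)))"
    by (rule has_chart_derivative_compose[OF chart_setD(2)[OF K] chart_setD(2)[OF H]]) (use Lb' in simp)
  from fun_cong[OF has_chart_derivative_unique[OF this LbQ]]
  have main: "R' (mfderiv Q B \<pi> a (fst v), mfderiv Q B \<pi> b (snd v)) = L' (fst v, snd v - \<Lambda> (A' v))" for v .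

  have "has_chart_derivative ?K1 (UNIV, id) (\<lambda>g. L (a, l g b)) \<one>\<^bsub>G\<^esub> (\<lambda>u. L' (0, \<Lambda> u))"
    by (rule has_chart_derivative_compose[OF one_chart(3) chart_setD(2)[OF K, unfolded K_def]
        has_chart_derivative_Pair[OF has_chart_derivative_const[OF one_chart(5) chart_Q(5)[OF a]] \<Lambda>(1)]])
      (use L' b in \<open>simp add: K_def\<close>)
  then have C: "mfderiv MG real_mfd (\<lambda>w. L (a, l w b)) \<one>\<^bsub>G\<^esub> = (\<lambda>u. L' (0, \<Lambda> u))"
    by (intro mfderiv_eq) (simp add: real_chart)
  have pL: "partial1 Q real_mfd L (a, b) = (\<lambda>v. L' (v, 0))" "partial2 Q real_mfd L (a, b) = (\<lambda>v. L' (0, v))"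
    using partial_eq[OF symmetry(4,4) a b, where N = real_mfd and f = L] L' by (simp_all add: K_def real_chart)
  have pLb: "partial1 B real_mfd Lb (\<pi> a, \<pi> b) = (\<lambda>v. R' (v, 0))" "partial2 B real_mfd Lb (\<pi> a, \<pi> b) = (\<lambda>v. R' (0, v))"
    using partial_eq[OF symmetry(6,6) pa pb, where N = real_mfd and f = Lb] Lb' by (simp_all add: H_def real_chart)
  have pA: "partial1 Q MG Ad (a, b) = (\<lambda>v. A' (v, 0))" "partial2 Q MG Ad (a, b) = (\<lambda>v. A' (0, v))"
    using partial_eq[OF symmetry(4,4) a b, where N = MG and f = Ad] A' by (simp_all add: K_def Ad_ab)
  have p0: "mfderiv Q B \<pi> a 0 = 0" "mfderiv Q B \<pi> b 0 = 0"
    using linear_0[OF linear_mfderiv_proj] a b by auto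
  have "L' (v, w - u) = L' (v, w) - L' (0, u)" for u v w
    using linear_diff[OF linL, of "(v, w)" "(0, u)"] by simp
  then show "partial1 B real_mfd Lb (\<pi> a, \<pi> b) (mfderiv Q B \<pi> a v) +
      mfderiv MG real_mfd (\<lambda>w. L (a, l w b)) \<one>\<^bsub>G\<^esub> (partial1 Q MG Ad (a, b) v) = partial1 Q real_mfd L (a, b) v"
    "partial2 B real_mfd Lb (\<pi> a, \<pi> b) (mfderiv Q B \<pi> b v) +
      mfderiv MG real_mfd (\<lambda>w. L (a, l w b)) \<one>\<^bsub>G\<^esub> (partial2 Q MG Ad (a, b) v) = partial2 Q real_mfd L (a, b) v"
    using main[of "(v, 0)"] main[of "(0, v)"] by (simp_all add: pL pLb pA C p0 del: diff_0)
qed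

text \<open>
  Differentiates \<open>L (l g x, l g y) = L (x, y)\<close>.
\<close>

lemma partial_L_invariant:
  assumes g: "g \<in> carrier G" and a: "a \<in> pts Q" and b: "b \<in> pts Q"
  shows "partial1 Q real_mfd L (l g a, l g b) (mfderiv Q Q (l g) a v) = partial1 Q real_mfd L (a, b) v"
    and "partial2 Q real_mfd L (l g a, l g b) (mfderiv Q Q (l g) b v) = partial2 Q real_mfd L (a, b) v"
proof -
  have ga: "l g a \<in> pts Q" and gb: "l g b \<in> pts Q" using assms by auto
  let ?K = "prod_chart (chart_at Q a) (chart_at Q b)"
  let ?gK = "prod_chart (chart_at Q (l g a)) (chart_at Q (l g b))"
  have K: "?K \<in> chart_set (prod_mfd Q Q)" and gK: "?gK \<in> chart_set (prod_mfd Q Q)"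
    by (intro chart_set_prod chart_Q a b ga gb)+
  obtain L1 where L1: "has_chart_derivative ?K (UNIV, id) L (a, b) L1" using L_derivative[OF a b] by blast
  obtain L2 where L2: "has_chart_derivative ?gK (UNIV, id) L (l g a, l g b) L2" using L_derivative[OF ga gb] by blast
  have "has_chart_derivative ?K ?gK (\<lambda>z. (l g (fst z), l g (snd z))) (a, b)
      (\<lambda>v. (mfderiv Q Q (l g) a (fst v), mfderiv Q Q (l g) b (snd v)))"
    by (rule has_chart_derivative_prod_map[OF chart_Q(2)[OF a] chart_Q(2)[OF b] chart_Q(5)[OF a] chart_Q(5)[OF b]
        l_derivative[OF g a] l_derivative[OF g b]])
  then have "has_chart_derivative ?K (UNIV, id) (\<lambda>z. L (l g (fst z), l g (snd z))) (a, b)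
      (\<lambda>v. L2 (mfderiv Q Q (l g) a (fst v), mfderiv Q Q (l g) b (snd v)))"
    by (rule has_chart_derivative_compose[OF chart_setD(2)[OF K] chart_setD(2)[OF gK]]) (use L2 in simp)
  then have "has_chart_derivative ?K (UNIV, id) L (a, b)
      (\<lambda>v. L2 (mfderiv Q Q (l g) a (fst v), mfderiv Q Q (l g) b (snd v)))"
  proof (rule has_chart_derivative_cong[OF K openin_topspace, rotated 2])
    show "(a, b) \<in> pts (prod_mfd Q Q)" using a b by (simp add: prod_mfd_def)
    fix z assume "z \<in> pts (prod_mfd Q Q)"
    then show "L (l g (fst z), l g (snd z)) = L z"
      using L_invariant[OF g] by (cases z) (simp add: prod_mfd_def)
  qed
  from fun_cong[OF has_chart_derivative_unique[OF this L1]]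
  have eq: "L2 (mfderiv Q Q (l g) a (fst v), mfderiv Q Q (l g) b (snd v)) = L1 v" for v .
  have zero: "mfderiv Q Q (l g) a 0 = 0" "mfderiv Q Q (l g) b 0 = 0"
    using linear_0[OF has_chart_derivative_linear[OF l_derivative]] g a b by auto
  show "partial1 Q real_mfd L (l g a, l g b) (mfderiv Q Q (l g) a v) = partial1 Q real_mfd L (a, b) v"
    "partial2 Q real_mfd L (l g a, l g b) (mfderiv Q Q (l g) b v) = partial2 Q real_mfd L (a, b) v"
    using partial_eq[OF symmetry(4,4) a b, where N = real_mfd and f = L] L1
      partial_eq[OF symmetry(4,4) ga gb, where N = real_mfd and f = L] L2
      eq[of "(v, 0)"] eq[of "(0, v)"] zero
    by (simp_all add: real_chart)
qed

text \<open>
  The reduced derivative plus the force at \<open>(\<pi> a, \<pi> b)\<close> equals the derivative of \<open>L\<close> along horizontal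
  lifts at the representative \<open>(l g a, l g b)\<close> used by the forces. Invariance of \<open>L\<close> and
  equivariance of the lift bring it back to \<open>(a, b)\<close>.
\<close>

lemma reduced_partials:
  assumes ab: "horizontal_pair a b"
  shows "partial1 B real_mfd Lb (\<pi> a, \<pi> b) \<delta> + Fm (\<pi> a, \<pi> b) \<delta> = partial1 Q real_mfd L (a, b) (h a \<delta>)"
    and "partial2 B real_mfd Lb (\<pi> a, \<pi> b) \<delta> + Fp (\<pi> a, \<pi> b) \<delta> = partial2 Q real_mfd L (a, b) (h b \<delta>)"
proof -
  note a = horizontal_pair_pts(1)[OF ab] and b = horizontal_pair_pts(2)[OF ab]
  obtain g where g: "g \<in> carrier G"
    and F: "\<And>v. Fm (\<pi> a, \<pi> b) v = mfderiv MG real_mfd (\<lambda>w. L (l g a, l w (l g b))) \<one>\<^bsub>G\<^esub>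
      (partial1 Q MG Ad (l g a, l g b) (h (l g a) v))"
    "\<And>v. Fp (\<pi> a, \<pi> b) v = mfderiv MG real_mfd (\<lambda>w. L (l g a, l w (l g b))) \<one>\<^bsub>G\<^esub>
      (partial2 Q MG Ad (l g a, l g b) (h (l g b) v))"
    using Fp_Fm_proj[OF ab] by blast
  have gab: "horizontal_pair (l g a) (l g b)" using horizontal_pair_l[OF ab g] .
  note red = reduced_derivative(2)[OF gab, of "h (l g a) \<delta>"] reduced_derivative(3)[OF gab, of "h (l g b) \<delta>"]
  show "partial1 B real_mfd Lb (\<pi> a, \<pi> b) \<delta> + Fm (\<pi> a, \<pi> b) \<delta> = partial1 Q real_mfd L (a, b) (h a \<delta>)"
    using red(1) F(1)[of \<delta>] hor_lift(2)[of "l g a" \<delta>] hor_lift_l[OF g a] partial_L_invariant(1)[OF g a b] g a b by simp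
  show "partial2 B real_mfd Lb (\<pi> a, \<pi> b) \<delta> + Fp (\<pi> a, \<pi> b) \<delta> = partial2 Q real_mfd L (a, b) (h b \<delta>)"
    using red(2) F(2)[of \<delta>] hor_lift(2)[of "l g b" \<delta>] hor_lift_l[OF g b] partial_L_invariant(2)[OF g a b] g a b by simp
qed

lemma linear_partial_L:
  assumes a: "a \<in> pts Q" and b: "b \<in> pts Q"
  shows "linear (partial1 Q real_mfd L (a, b))" "linear (partial2 Q real_mfd L (a, b))"
proof -
  obtain L' where L': "has_chart_derivative (prod_chart (chart_at Q a) (chart_at Q b)) (UNIV, id) L (a, b) L'"
    using L_derivative[OF a b] by blast
  have lin: "linear L'"
    by (rule has_chart_derivative_linear[OF L'])
  have "linear (\<lambda>v. L' (v, 0))" "linear (\<lambda>v. L' (0, v))"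
    using linear_add[OF lin, of "(_, 0)" "(_, 0)"] linear_add[OF lin, of "(0, _)" "(0, _)"]
      linear_scale[OF lin, of _ "(_, 0)"] linear_scale[OF lin, of _ "(0, _)"]
    by (auto intro!: linearI)
  then show "linear (partial1 Q real_mfd L (a, b))" "linear (partial2 Q real_mfd L (a, b))"
    using partial_eq[OF symmetry(4,4) a b, where N = real_mfd and f = L] L' by (simp_all add: real_chart)
qed

end

section \<open>The equivalence of the four conditions\<close>

theorem theorem10p7:
  fixes Q :: "('q, 'e::real_normed_vector) mfd"
    and MG :: "('g, 'f::real_normed_vector) mfd"
    and G :: "('g, 'z) monoid_scheme"
    and l :: "'g \<Rightarrow> 'q \<Rightarrow> 'q"
    and B :: "('q set, 'h::real_normed_vector) mfd"
    and L :: "'q \<times> 'q \<Rightarrow> real"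
    and D :: "'q \<Rightarrow> 'e set"
    and Dd :: "('q \<times> 'q) set"
    and \<gamma> :: "'q \<Rightarrow> 'g"
    and U :: "('q \<times> 'q) set"
    and \<O> :: "('q set \<times> 'q set) set"
    and Ad :: "'q \<times> 'q \<Rightarrow> 'g"
    and hb :: "'q \<Rightarrow> 'q set \<Rightarrow> 'q"
    and h :: "'q \<Rightarrow> 'h \<Rightarrow> 'e"
    and Lb :: "'q set \<times> 'q set \<Rightarrow> real"
    and Fp Fm :: "'q set \<times> 'q set \<Rightarrow> 'h \<Rightarrow> real"
    and N :: nat
    and q :: "nat \<Rightarrow> 'q"
    and r :: "nat \<Rightarrow> 'q set"
  assumes system: "nonholonomic_discrete_system Q L D Dd"
    and chaplygin: "chaplygin_symmetry_group MG G l B Q L D Dd \<gamma>"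
    and nbhds: "conn_neighbourhoods Q MG G l B \<gamma> Dd U \<O>"
    and Ad: "Ad = disc_conn G l Dd U"
    and hb: "hb = disc_hor_lift Q G l Ad"
    and h: "h = hor_lift Q G l B D"
    and Lb: "Lb = breve_L G l L hb"
    and Fp: "Fp = breve_F_plus Q MG G l L Ad hb h"
    and Fm: "Fm = breve_F_minus Q MG G l L Ad hb h"
    and curve: "\<forall>k\<le>N. q k \<in> pts Q"
    and reduced_curve: "\<forall>k. r k = orbit G l (q k)"
    and horizontal: "\<forall>k<N. (q k, q (k + 1)) \<in> Dd"
    and horizontal_domain: "\<forall>k<N. (q k, q (k + 1)) \<in> U \<inter> conn_domain Q G l \<O>"
  shows "let
      P1 = (\<forall>\<delta>q :: nat \<Rightarrow> 'e.
        \<delta>q 0 = 0 \<and> \<delta>q N = 0 \<and> (\<forall>k\<le>N. \<delta>q k \<in> D (q k)) \<longrightarrow>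
        curve_differential Q (disc_action L N) q \<delta>q = 0);
      P2 = ((\<forall>k. 1 \<le> k \<and> k < N \<longrightarrow>
          (\<lambda>v. partial1 Q real_mfd L (q k, q (k + 1)) v + partial2 Q real_mfd L (q (k - 1), q k) v)
            \<in> annihilator (D (q k))) \<and>
        (\<forall>k<N. (q k, q (k + 1)) \<in> Dd));
      P3 = (\<forall>\<delta>r :: nat \<Rightarrow> 'h. \<delta>r 0 = 0 \<and> \<delta>r N = 0 \<longrightarrow>
        curve_differential B (disc_action Lb N) r \<delta>r =
          - (\<Sum>k = 1..<N. Fm (r k, r (k + 1)) (\<delta>r k) + Fp (r (k - 1), r k) (\<delta>r k)));
      P4 = (\<forall>k. 1 \<le> k \<and> k < N \<longrightarrow>
        (\<lambda>v. partial1 B real_mfd Lb (r k, r (k + 1)) v + partial2 B real_mfd Lb (r (k - 1), r k) v) =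
        (\<lambda>v. - (Fp (r (k - 1), r k) v + Fm (r k, r (k + 1)) v)))
    in (P1 \<longleftrightarrow> P2) \<and> (P2 \<longleftrightarrow> P3) \<and> (P3 \<longleftrightarrow> P4)"
proof -
  interpret chaplygin_reduction Q MG G l B L D Dd \<gamma> U \<O> Ad hb h Lb Fp Fm
    by unfold_locales (fact system chaplygin nbhds Ad hb h Lb Fp Fm)+
  have hp: "horizontal_pair (q k) (q (Suc k))" if "k < N" for k
    using horizontal horizontal_domain that by (intro horizontal_pairI) auto
  have rq: "r k = \<pi> (q k)" for k using reduced_curve by simp
  have q: "q k \<in> pts Q" if "k \<le> N" for k using curve that by simp
  define E where "E = (\<lambda>k v. partial1 Q real_mfd L (q k, q (k + 1)) v + partial2 Q real_mfd L (q (k - 1), q k) v)"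
  define E' where "E' = (\<lambda>k v. partial1 B real_mfd Lb (r k, r (k + 1)) v + partial2 B real_mfd Lb (r (k - 1), r k) v)"
  define F where "F = (\<lambda>k v. Fm (r k, r (k + 1)) v + Fp (r (k - 1), r k) v)"
  have red: "E' k \<delta> + F k \<delta> = E k (h (q k) \<delta>)" if k: "1 \<le> k \<and> k < N" for k \<delta>
  proof -
    have "k < N" "k - 1 < N" "Suc (k - 1) = k" using k by auto
    then show ?thesis
      using reduced_partials(1)[OF hp[of k], of \<delta>] reduced_partials(2)[OF hp[of "k - 1"], of \<delta>]
      by (simp add: E_def E'_def F_def rq)
  qed
  have linE: "linear (E k)" if k: "1 \<le> k \<and> k < N" for k
    unfolding E_def using k q by (intro linear_compose_add linear_partial_L) auto
  have E0: "E k 0 = 0" if "1 \<le> k \<and> k < N" for k using linear_0[OF linE[OF that]] .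
  have h0: "h (q k) 0 = 0" if "k \<le> N" for k
    using hor_lift_eqI[OF q[OF that], of 0 0] D_subspace[OF q[OF that]] linear_0[OF linear_mfderiv_proj[OF q[OF that]]]
    by (simp add: subspace_0)

  \<comment> \<open>Each of the four conditions is brought to one of these two pointwise forms.\<close>
  let ?EL = "\<forall>k. 1 \<le> k \<and> k < N \<longrightarrow> (\<forall>v\<in>D (q k). E k v = 0)"
  let ?EL' = "\<forall>k. 1 \<le> k \<and> k < N \<longrightarrow> (\<forall>\<delta>\<in>UNIV. E' k \<delta> + F k \<delta> = 0)"
  have EL: "?EL \<longleftrightarrow> ?EL'"
  proof -
    have "(\<forall>v\<in>D (q k). E k v = 0) \<longleftrightarrow> (\<forall>\<delta>\<in>UNIV. E' k \<delta> + F k \<delta> = 0)" if k: "1 \<le> k \<and> k < N" for k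
    proof -
      have qk: "q k \<in> pts Q" using k q by simp
      have "h (q k) (mfderiv Q B \<pi> (q k) v) = v" if "v \<in> D (q k)" for v
        using hor_lift_eqI[OF qk that] by simp
      then show ?thesis using red[OF k] hor_lift(1)[OF qk] by (metis UNIV_I)
    qed
    then show ?thesis by blast
  qed
  have P1: "(\<forall>\<delta>q. \<delta>q 0 = 0 \<and> \<delta>q N = 0 \<and> (\<forall>k\<le>N. \<delta>q k \<in> D (q k)) \<longrightarrow>
      curve_differential Q (disc_action L N) q \<delta>q = 0) \<longleftrightarrow> ?EL" (is "?P1 \<longleftrightarrow> _")
  proof -
    have "curve_differential Q (disc_action L N) q \<delta>q = (\<Sum>k = 1..<N. E k (\<delta>q k))"
      if "\<delta>q 0 = 0" "\<delta>q N = 0" for \<delta>q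
      unfolding E_def using q L_derivative that
      by (intro curve_differential_vanishing_ends symmetry) auto
    then have "?P1 \<longleftrightarrow> (\<forall>\<delta>q. \<delta>q 0 = 0 \<and> \<delta>q N = 0 \<and> (\<forall>k\<le>N. \<delta>q k \<in> D (q k)) \<longrightarrow>
      (\<Sum>k = 1..<N. E k (\<delta>q k)) = 0)" by auto
    also have "\<dots> \<longleftrightarrow> ?EL"
      using D_subspace q E0 by (intro variations_vanish_iff) (auto simp: subspace_0)
    finally show ?thesis .
  qed
  have P2: "((\<forall>k. 1 \<le> k \<and> k < N \<longrightarrow>
          (\<lambda>v. partial1 Q real_mfd L (q k, q (k + 1)) v + partial2 Q real_mfd L (q (k - 1), q k) v)
            \<in> annihilator (D (q k))) \<and> (\<forall>k<N. (q k, q (k + 1)) \<in> Dd)) \<longleftrightarrow> ?EL"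
    using linE horizontal by (auto simp: annihilator_def E_def)
  have P3: "(\<forall>\<delta>r. \<delta>r 0 = 0 \<and> \<delta>r N = 0 \<longrightarrow> curve_differential B (disc_action Lb N) r \<delta>r =
          - (\<Sum>k = 1..<N. Fm (r k, r (k + 1)) (\<delta>r k) + Fp (r (k - 1), r k) (\<delta>r k))) \<longleftrightarrow> ?EL'" (is "?P3 \<longleftrightarrow> _")
  proof -
    have r: "r k \<in> pts B" if "k \<le> N" for k using q[OF that] by (simp add: rq)
    have "curve_differential B (disc_action Lb N) r \<delta>r = (\<Sum>k = 1..<N. E' k (\<delta>r k))"
      if "\<delta>r 0 = 0" "\<delta>r N = 0" for \<delta>r
      unfolding E'_def
      using r reduced_derivative(1)[OF hp] that
      by (intro curve_differential_vanishing_ends symmetry) (auto simp: rq)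
    then have "?P3 \<longleftrightarrow> (\<forall>\<delta>r. \<delta>r 0 = 0 \<and> \<delta>r N = 0 \<and> (\<forall>k\<le>N. \<delta>r k \<in> UNIV) \<longrightarrow>
      (\<Sum>k = 1..<N. E' k (\<delta>r k) + F k (\<delta>r k)) = 0)"
      by (auto simp: F_def sum.distrib eq_neg_iff_add_eq_0)
    also have "\<dots> \<longleftrightarrow> ?EL'"
      using red E0 h0 by (intro variations_vanish_iff) auto
    finally show ?thesis .
  qed
  have P4: "(\<forall>k. 1 \<le> k \<and> k < N \<longrightarrow>
        (\<lambda>v. partial1 B real_mfd Lb (r k, r (k + 1)) v + partial2 B real_mfd Lb (r (k - 1), r k) v) =
        (\<lambda>v. - (Fp (r (k - 1), r k) v + Fm (r k, r (k + 1)) v))) \<longleftrightarrow> ?EL'"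
  proof -
    have "a + b = - (c + d) \<longleftrightarrow> a + b + (d + c) = 0" for a b c d :: real by linarith
    then show ?thesis by (simp only: E'_def F_def fun_eq_iff ball_UNIV)
  qed
  show ?thesis unfolding Let_def P1 P2 P3 P4 EL by (intro conjI refl)
qed

end
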